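(* Let $p\ge 2$ be a prime, let $0\le j<i\le p-1$, let $r\ge p$, and let $r_0$ be the constant term in the base $p$-expansion of $r$ (so $0\le r_0\le p-1$ and $r\equiv r_0 \bmod p$). Then the submodules $X_{r-j,\,r}$ and $X_{r-i,\,r}$ of $V_r$ are equal if and only if all three of the following hold: $i$ and $j$ have the same carry patterns (with respect to $r$), $\Sigma_p(r-j)\le p-1$, and $\Sigma_p(r-r_0)\le j$.
   Context: Let $\Gamma=\mathrm{GL}_2(\mathbb{F}_p)$. $V_r$ is the $\mathbb{F}_p$-space of homogeneous polynomials $F(X,Y)$ of degree $r$ over $\mathbb{F}_p$, with $\Gamma$-action $\begin{pmatrix} a&b\\c&d\end{pmatrix}\cdot F(X,Y)=F(aX+cY,\,bX+dY)$. For $0\le l\le r$, $X_{r-l,\,r}\subseteq V_r$ is the $\mathbb{F}_p[\Gamma]$-submodule generated by the monomial $X^{r-l}Y^{l}$. $\Sigma_p(n)$ is the sum of the digits of the base $p$-expansion of $n\ge 0$. Carry pattern: for $0\le l\le r$ write the base $p$-digits of $r$, $l$, $r-l$ as $r_n$, $l_n$, $(r-l)_n$ ($n\ge0$). The carry pattern of $l$ (with respect to $r$) is the sequence $(c_1,c_2,\dots)$ of $0$s and $1$s recording the carries in the base $p$ addition $l+(r-l)=r$; that is, with $c_0=0$, $l_n+(r-l)_n+c_n=r_n+p\,c_{n+1}$ for all $n\ge 0$. *)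

theory Defs
  imports "HOL-Analysis.Analysis" "Berlekamp_Zassenhaus.Finite_Field"
begin

text \<open>
  A polynomial in \<open>X\<close>, \<open>Y\<close> over a field \<open>'k\<close> is an element of \<open>'k poly poly\<close>, read as
  \<open>'k[X][Y]\<close>: the coefficient of \<open>X\<^sup>m Y\<^sup>n\<close> in \<open>F\<close> is \<open>coeff (coeff F n) m\<close>.
\<close>

definition bvar_X :: "'k::field poly poly" where
  "bvar_X = [:[:0, 1:]:]"

definition bvar_Y :: "'k::field poly poly" where
  "bvar_Y = [:0, 1:]"

definition bconst :: "'k::field \<Rightarrow> 'k poly poly" where
  "bconst c = [:[:c:]:]"

definition bscale :: "'k::field \<Rightarrow> 'k poly poly \<Rightarrow> 'k poly poly" where
  "bscale c F = bconst c * F"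

global_interpretation bivar: vector_space "bscale :: 'k::field \<Rightarrow> 'k poly poly \<Rightarrow> 'k poly poly"
proof
  fix a b :: 'k and F G :: "'k poly poly"
  have "bconst (a + b) = bconst a + bconst b" "bconst (a * b) = bconst a * bconst b" "bconst (1::'k) = 1"
    by (simp_all add: bconst_def one_pCons)
  then show "bscale a (F + G) = bscale a F + bscale a G" "bscale (a + b) F = bscale a F + bscale b F"
    "bscale a (bscale b F) = bscale (a * b) F" "bscale 1 F = F"
    by (simp_all add: bscale_def algebra_simps)
qed

lemma bvar_monomial:
  "bvar_X ^ a * bvar_Y ^ b = (Polynomial.monom (Polynomial.monom 1 a) b :: 'k::field poly poly)"
proof -
  have X: "bvar_X ^ a = ([:Polynomial.monom 1 a:] :: 'k poly poly)"
  proof (induction a)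
    case 0
    show ?case by (simp add: Polynomial.monom_0 one_pCons)
  next
    case (Suc a)
    show ?case
      by (simp add: Suc) (simp add: bvar_X_def Polynomial.monom_Suc)
  qed
  have Y: "bvar_Y ^ b = (Polynomial.monom 1 b :: 'k poly poly)"
    by (simp add: bvar_Y_def monom_altdef)
  show ?thesis
    by (simp add: X Y Polynomial.smult_monom)
qed

definition homogeneous_polys :: "nat \<Rightarrow> 'k::field poly poly set" where
  "homogeneous_polys r = {F. \<forall>m n. Polynomial.coeff (Polynomial.coeff F n) m \<noteq> 0 \<longrightarrow> m + n = r}"

definition bsubst :: "'k::field poly poly \<Rightarrow> 'k poly poly \<Rightarrow> 'k poly poly \<Rightarrow> 'k poly poly" where
  "bsubst F P Q =
     (\<Sum>n\<le>Polynomial.degree F. \<Sum>m\<le>Polynomial.degree (Polynomial.coeff F n).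
        bscale (Polynomial.coeff (Polynomial.coeff F n) m) (P ^ m * Q ^ n))"

definition gl2_act :: "'k::field ^ 2 ^ 2 \<Rightarrow> 'k poly poly \<Rightarrow> 'k poly poly" where
  "gl2_act A F = bsubst F (bscale (A $ 1 $ 1) bvar_X + bscale (A $ 2 $ 1) bvar_Y)
                          (bscale (A $ 1 $ 2) bvar_X + bscale (A $ 2 $ 2) bvar_Y)"

lemma gl2_act_monomial:
  "gl2_act A (bvar_X ^ a * bvar_Y ^ b) =
     (bscale (A $ 1 $ 1) bvar_X + bscale (A $ 2 $ 1) bvar_Y) ^ a *
     (bscale (A $ 1 $ 2) bvar_X + bscale (A $ 2 $ 2) bvar_Y) ^ b"
proof -
  have "bsubst M P Q = P ^ a * Q ^ b"
    if M: "M = Polynomial.monom (Polynomial.monom 1 a) b" for M P Q :: "'a poly poly"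
  proof -
    have d: "Polynomial.degree (Polynomial.monom (1::'a) a) = a" "Polynomial.degree M = b"
      unfolding M by (simp_all add: Polynomial.degree_monom_eq)
    have "(\<Sum>m\<le>Polynomial.degree (Polynomial.coeff M n).
          bscale (Polynomial.coeff (Polynomial.coeff M n) m) (P ^ m * Q ^ n)) =
        (if n = b then P ^ a * Q ^ b else 0)" for n
    proof (cases "n = b")
      case True
      have "(\<Sum>m\<le>a. bscale (Polynomial.coeff (Polynomial.monom 1 a) m) (P ^ m * Q ^ n)) =
          (\<Sum>m\<le>a. if m = a then P ^ a * Q ^ b else 0)"
        using True by (intro sum.cong) auto
      with True show ?thesis
        by (simp add: M d(1))
    qed (simp add: M)
    then show ?thesis
      by (simp add: bsubst_def d(2))
  qed
  then show ?thesis
    by (simp only: gl2_act_def bvar_monomial)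
qed

definition gl2_submodule :: "nat \<Rightarrow> 'k::field poly poly set \<Rightarrow> bool" where
  "gl2_submodule r W \<longleftrightarrow>
     W \<subseteq> homogeneous_polys r \<and> bivar.subspace W \<and>
     (\<forall>A :: 'k ^ 2 ^ 2. invertible A \<longrightarrow> (\<forall>F\<in>W. gl2_act A F \<in> W))"

lemma homogeneous_mult:
  assumes "F \<in> homogeneous_polys a" and "G \<in> homogeneous_polys b"
  shows "F * G \<in> homogeneous_polys (a + b)"
proof -
  have "m + n = a + b" if "Polynomial.coeff (Polynomial.coeff (F * G) n) m \<noteq> 0" for m n
  proof -
    have "(\<Sum>k\<le>n. \<Sum>l\<le>m. Polynomial.coeff (Polynomial.coeff F k) l *
        Polynomial.coeff (Polynomial.coeff G (n - k)) (m - l)) \<noteq> 0"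
      using that by (simp add: Polynomial.coeff_mult coeff_sum)
    then obtain k where k: "k \<le> n" "(\<Sum>l\<le>m. Polynomial.coeff (Polynomial.coeff F k) l *
        Polynomial.coeff (Polynomial.coeff G (n - k)) (m - l)) \<noteq> 0"
      by (metis (no_types, lifting) atMost_iff sum.neutral)
    then obtain l where l: "l \<le> m" "Polynomial.coeff (Polynomial.coeff F k) l *
        Polynomial.coeff (Polynomial.coeff G (n - k)) (m - l) \<noteq> 0"
      by (metis (no_types, lifting) atMost_iff sum.neutral)
    then have "l + k = a" "(m - l) + (n - k) = b"
      using assms by (auto simp: homogeneous_polys_def)
    with k(1) l(1) show ?thesis
      by linarith
  qed
  then show ?thesis
    by (auto simp: homogeneous_polys_def)
qed

lemma subspace_homogeneous: "bivar.subspace (homogeneous_polys r)"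
proof (rule bivar.subspaceI)
  fix F G :: "'a poly poly"
  assume FG: "F \<in> homogeneous_polys r" "G \<in> homogeneous_polys r"
  have "m + n = r" if "Polynomial.coeff (Polynomial.coeff (F + G) n) m \<noteq> 0" for m n
    using FG that by (cases "Polynomial.coeff (Polynomial.coeff F n) m = 0")
      (auto simp: homogeneous_polys_def)
  then show "F + G \<in> homogeneous_polys r"
    by (auto simp: homogeneous_polys_def)
qed (auto simp: homogeneous_polys_def bscale_def bconst_def)

lemma homogeneous_power:
  "F \<in> homogeneous_polys a \<Longrightarrow> F ^ n \<in> homogeneous_polys (n * a)"
proof (induction n)
  case 0
  show ?case
    by (auto simp: homogeneous_polys_def Polynomial.coeff_1 split: if_splits)
next
  case (Suc n)
  then show ?case
    using homogeneous_mult[of F a "F ^ n" "n * a"] by simp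
qed

lemma gl2_submodule_homogeneous: "gl2_submodule r (homogeneous_polys r)"
proof -
  have lin: "bscale c bvar_X + bscale d bvar_Y \<in> homogeneous_polys 1" for c d :: 'a
  proof -
    have "bvar_X \<in> homogeneous_polys 1" "(bvar_Y :: 'a poly poly) \<in> homogeneous_polys 1"
      by (auto simp: homogeneous_polys_def bvar_X_def bvar_Y_def Polynomial.coeff_pCons
          Polynomial.coeff_1 split: nat.splits if_splits)
    then show ?thesis
      by (intro bivar.subspace_add bivar.subspace_scale subspace_homogeneous)
  qed
  have "gl2_act A F \<in> homogeneous_polys r" if F: "F \<in> homogeneous_polys r"
    for A :: "'a ^ 2 ^ 2" and F
    unfolding gl2_act_def bsubst_def
  proof (intro bivar.subspace_sum subspace_homogeneous)
    fix n m
    let ?P = "bscale (A $ 1 $ 1) bvar_X + bscale (A $ 2 $ 1) bvar_Y"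
    let ?Q = "bscale (A $ 1 $ 2) bvar_X + bscale (A $ 2 $ 2) bvar_Y"
    let ?c = "Polynomial.coeff (Polynomial.coeff F n) m"
    show "bscale ?c (?P ^ m * ?Q ^ n) \<in> homogeneous_polys r"
    proof (cases "?c = 0")
      case True
      then show ?thesis
        by (simp add: bivar.subspace_0 subspace_homogeneous)
    next
      case False
      then have "m * 1 + n * 1 = r"
        using F by (auto simp: homogeneous_polys_def)
      then show ?thesis
        using homogeneous_mult[OF homogeneous_power[OF lin] homogeneous_power[OF lin]]
        by (metis bivar.subspace_scale subspace_homogeneous)
    qed
  qed
  then show ?thesis
    by (simp add: gl2_submodule_def subspace_homogeneous)
qed

text \<open>For \<open>m \<le> r\<close>, the submodule of \<open>homogeneous_polys r\<close> generated by \<open>X\<^sup>m Y\<^bsup>r-m\<^esup>\<close>.\<close>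

definition monomial_submodule :: "nat \<Rightarrow> nat \<Rightarrow> 'k::field poly poly set" where
  "monomial_submodule m r = gl2_submodule r hull {bvar_X ^ m * bvar_Y ^ (r - m)}"

definition base_digit :: "nat \<Rightarrow> nat \<Rightarrow> nat \<Rightarrow> nat" where
  "base_digit p a n = a div p ^ n mod p"

text \<open>For \<open>p \<ge> 2\<close> we have \<open>a < p ^ a\<close>, so all digits of \<open>a\<close> at positions above \<open>a\<close> vanish.\<close>

definition digit_sum :: "nat \<Rightarrow> nat \<Rightarrow> nat" where
  "digit_sum p a = (\<Sum>n\<le>a. base_digit p a n)"

fun add_carry :: "nat \<Rightarrow> nat \<Rightarrow> nat \<Rightarrow> nat \<Rightarrow> nat" where
  "add_carry p a b 0 = 0"
| "add_carry p a b (Suc n) = (base_digit p a n + base_digit p b n + add_carry p a b n) div p"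

text \<open>Index \<open>n\<close> of the carry pattern is the carry \<open>c\<close> with subscript \<open>n + 1\<close>.\<close>

definition carry_pattern :: "nat \<Rightarrow> nat \<Rightarrow> nat \<Rightarrow> nat \<Rightarrow> nat" where
  "carry_pattern p r l = (\<lambda>n. add_carry p l (r - l) (Suc n))"

lemma add_carry_le_1:
  assumes "p \<ge> 2"
  shows "add_carry p a b n \<le> 1"
proof (induction n)
  case (Suc n)
  have "base_digit p a n < p" "base_digit p b n < p"
    using assms by (simp_all add: base_digit_def)
  then have "base_digit p a n + base_digit p b n + add_carry p a b n < p * 2"
    using Suc by linarith
  then show ?case
    using less_mult_imp_div_less[of "base_digit p a n + base_digit p b n + add_carry p a b n" 2 p]
    by (simp add: mult.commute)
qed simp

lemma add_carry_eq:
  assumes "p \<ge> 2"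
  shows "base_digit p a n + base_digit p b n + add_carry p a b n =
         base_digit p (a + b) n + p * add_carry p a b (Suc n)"
proof -
  have *: "(a + b) div p ^ n = a div p ^ n + b div p ^ n + add_carry p a b n" for n
  proof (induction n)
    case (Suc n)
    have s: "x = p * (x div p) + x mod p" for x :: nat
      by simp
    have "(a + b) div p ^ Suc n = (a div p ^ n + b div p ^ n + add_carry p a b n) div p"
      by (simp only: Suc[symmetric] power_Suc2 div_mult2_eq)
    also have "a div p ^ n + b div p ^ n + add_carry p a b n =
      (base_digit p a n + base_digit p b n + add_carry p a b n) +
        p * (a div p ^ n div p + b div p ^ n div p)"
      unfolding base_digit_def using s[of "a div p ^ n"] s[of "b div p ^ n"]
      by (simp add: algebra_simps)
    also have "\<dots> div p = add_carry p a b (Suc n) + (a div p ^ n div p + b div p ^ n div p)"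
      using assms by simp
    finally show ?case
      by (simp only: power_Suc2 div_mult2_eq add_ac)
  qed simp
  have "base_digit p (a + b) n = (base_digit p a n + base_digit p b n + add_carry p a b n) mod p"
    unfolding base_digit_def * by (metis mod_add_eq mod_add_left_eq)
  then show ?thesis
    by simp
qed

end

theory Submission
  imports Defs
begin

text \<open>
  Write \<open>M\<^sub>l\<close> for the submodule generated by \<open>X\<^bsup>r-l\<^esup> Y\<^sup>l\<close>, and put \<open>N = r - j\<close>, \<open>N = N\<^sub>0 + p Q\<close> with
  \<open>0 \<le> N\<^sub>0 < p\<close>.

  \<^emph>\<open>Reduction to one variable.\<close> Applying \<open>Y \<mapsto> X + Y\<close> to \<open>X\<^bsup>r-i\<^esup> Y\<^sup>i\<close> produces all monomials
  \<open>X\<^bsup>r-k\<^esup> Y\<^sup>k\<close> with \<open>k \<le> i\<close>, with coefficients that are nonzero because \<open>i < p\<close>, and averaging over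
  the diagonal matrices separates them. So \<open>M\<^sub>j \<subseteq> M\<^sub>i\<close> always, and equality means
  \<open>X\<^bsup>r-i\<^esup> Y\<^sup>i \<in> M\<^sub>j\<close>. The module \<open>M\<^sub>j\<close> is spanned by the products \<open>L\<^sup>N G\<close> with \<open>L\<close> a linear form and
  \<open>G\<close> a form of degree \<open>j\<close>. The diagonal matrices see the exponent of \<open>Y\<close> only modulo \<open>p - 1\<close>, and
  in the weight space of \<open>i\<close> every \<open>L = a X + c Y\<close> with \<open>a, c \<noteq> 0\<close> gives the same space as
  \<open>L = X + Y\<close>, while \<open>L = X\<close> and \<open>L = Y\<close> contribute only exponents \<open>n \<le> j\<close> and \<open>n \<ge> N\<close> of \<open>Y\<close>.
  Setting \<open>X = 1\<close>, membership comes down to this if \<open>i < N\<close>: there is a polynomial \<open>A\<close> of degree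
  at most \<open>j\<close> such that among the coefficients of \<open>(1 + Y)\<^sup>N A\<close> at the exponents \<open>n \<equiv> i\<close> modulo \<open>p - 1\<close> with
  \<open>j < n < N\<close>, exactly the one at \<open>n = i\<close> is nonzero.

  \<^emph>\<open>Solving the one-variable problem.\<close> In characteristic \<open>p\<close> we have
  \<open>(1 + Y)\<^sup>N A = h (1 + Y\<^sup>p)\<^sup>Q\<close> with \<open>h = (1 + Y)\<^bsup>N\<^sub>0\<^esup> A\<close>, and the coefficient at \<open>a + p m\<close> is
  essentially \<open>h\<^sub>a\<close> times the binomial coefficient of \<open>Q\<close> over \<open>m\<close>. The binomial coefficients that do
  not vanish modulo \<open>p\<close> have digit sums \<open>\<Sigma>(m)\<close> filling exactly the range from \<open>0\<close> to \<open>\<Sigma>(Q)\<close>, and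
  \<open>a + p m \<equiv> a + \<Sigma>(m)\<close> modulo \<open>p - 1\<close>. So \<open>h\<close> must have a nonzero coefficient at \<open>i\<close> and zeros just
  below \<open>i\<close>: if \<open>h\<close> has degree less than \<open>p\<close>, zeros at \<open>i - 1, \<dots>, i - \<Sigma>(Q)\<close> suffice, and a
  large \<open>\<Sigma>(Q)\<close> forces many of them. A nonzero multiple of \<open>(1 + Y)\<^sup>e\<close> of degree less than \<open>p\<close>
  has more than \<open>e\<close> nonzero coefficients (lemma \<open>sparse_multiple_eq_0\<close>), and any \<open>e + 1\<close>
  positions below \<open>p\<close> are the support of such a multiple (lemma \<open>ex_sparse_multiple\<close>). Counting
  positions, \<open>M\<^sub>i = M\<^sub>j\<close> if and only if \<open>i \<le> N\<^sub>0 + j\<close> and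
  \<open>\<Sigma>(N) \<le> min (p - 1) (N\<^sub>0 + j)\<close> (lemma \<open>monomial_submodules_eq_iff_digits\<close>).

  \<^emph>\<open>Carries.\<close> For \<open>l < p\<close> the carry pattern of \<open>l\<close> is determined by its first entry, which records
  whether \<open>l > r\<^sub>0\<close>. Splitting according to whether \<open>j \<le> r\<^sub>0\<close>, where \<open>N\<^sub>0 + j\<close> is \<open>r\<^sub>0\<close>
  or \<open>r\<^sub>0 + p\<close>, turns the digit criterion into the three conditions of the theorem.
\<close>

hide_const (open) UnivPoly.coeff UnivPoly.monom Module.smult

section \<open>Sparse multiples of powers of 1 + Y\<close>

lemma linear_power_dvd_pderiv:
  fixes h :: "'k::field poly"
  assumes "[:1, 1:] ^ Suc e dvd h"
  shows "[:1, 1:] ^ e dvd pderiv h"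
proof -
  obtain u where h: "h = [:1, 1:] ^ Suc e * u"
    using assms by (elim dvdE)
  have "[:1, 1:] ^ e dvd ([:1, 1:] ^ Suc e :: 'k poly)"
    by (rule le_imp_power_dvd) simp
  moreover have "[:1, 1:] ^ e dvd pderiv ([:1, 1:] ^ Suc e :: 'k poly)"
    unfolding pderiv_power_Suc by (metis dvd_triv_left dvd_smult mult_smult_left)
  ultimately show ?thesis
    unfolding h pderiv_mult by (intro dvd_add dvd_mult2[of _ "[:1, 1:] ^ Suc e"] dvd_mult)
qed

text \<open>
  A polynomial analogue of Descartes' rule of signs. If \<open>h\<close> has a nonzero coefficient at \<open>a\<close>, then
  the operator \<open>Y d/dY - a\<close> removes exactly that coefficient, because distinct exponents below the
  characteristic stay distinct in the field, and it lowers the order of vanishing at \<open>-1\<close> by at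
  most one. By induction \<open>h\<close> is a monomial, which does not vanish at \<open>-1\<close>.
\<close>

lemma sparse_multiple_eq_0:
  fixes h :: "'k::field poly"
  assumes "[:1, 1:] ^ e dvd h" and "degree h < CHAR('k)" and "card {n. coeff h n \<noteq> 0} \<le> e"
  shows "h = 0"
  using assms
proof (induction e arbitrary: h)
  case 0
  have "finite {n. coeff h n \<noteq> 0}"
    by (rule finite_subset[of _ "{..degree h}"]) (auto simp: le_degree)
  with 0 show ?case
    by (auto simp: poly_eq_iff)
next
  case (Suc e)
  have fin: "finite {n. coeff h n \<noteq> 0}"
    by (rule finite_subset[of _ "{..degree h}"]) (auto simp: le_degree)
  show ?case
  proof (rule ccontr)
    assume "h \<noteq> 0"
    then obtain a where a: "coeff h a \<noteq> 0"
      by (auto simp: poly_eq_iff)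
    \<comment> \<open>The operator \<open>Y d/dY - a\<close>, which multiplies the coefficient at \<open>n\<close> by \<open>n - a\<close>.\<close>
    define g where "g = pCons 0 (pderiv h) - smult (of_nat a) h"
    have g: "coeff g n = (of_nat n - of_nat a) * coeff h n" for n
      by (cases n) (auto simp: g_def coeff_pderiv algebra_simps)
    have "[:1, 1:] ^ e dvd [:0, 1:] * pderiv h"
      by (intro dvd_mult linear_power_dvd_pderiv Suc.prems)
    moreover have "[:1, 1:] ^ e dvd smult (of_nat a) h"
      by (intro dvd_smult dvd_trans[OF _ Suc.prems(1)] le_imp_power_dvd) simp
    ultimately have "[:1, 1:] ^ e dvd g"
      unfolding g_def by (intro dvd_diff) auto
    moreover have "degree g < CHAR('k)"
      using Suc.prems(2) degree_le[of "degree h" g] by (auto simp: g coeff_eq_0)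
    moreover have "card {n. coeff g n \<noteq> 0} \<le> e"
    proof -
      have "card {n. coeff g n \<noteq> 0} \<le> card ({n. coeff h n \<noteq> 0} - {a})"
        by (rule card_mono) (use fin in \<open>auto simp: g\<close>)
      then show ?thesis
        using a Suc.prems(3) fin by simp
    qed
    ultimately have "g = 0"
      by (rule Suc.IH)
    have "coeff h n = 0" if "n \<noteq> a" for n
    proof (rule ccontr)
      assume n: "coeff h n \<noteq> 0"
      with \<open>g = 0\<close> g[of n] have "of_nat n = (of_nat a :: 'k)"
        by simp
      moreover have "n < CHAR('k)" "a < CHAR('k)"
        using a n Suc.prems(2) le_degree by (meson le_less_trans)+
      ultimately show False
        using that by (metis cong_def mod_less of_nat_eq_iff_cong_CHAR)
    qed
    then have h: "h = monom (coeff h a) a"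
      by (auto simp: poly_eq_iff)
    have "[:1, 1:] dvd h"
      using Suc.prems(1) by (meson dvd_power dvd_trans zero_less_Suc)
    then have "poly h (- 1) = 0"
      by (auto elim!: dvdE)
    then show False
      using a by (subst (asm) h) (simp add: poly_monom)
  qed
qed

text \<open>
  The previous bound is sharp, by induction on \<open>e\<close>: two such multiples of \<open>(1 + Y)\<^sup>e\<close>, supported
  on \<open>S\<close> without \<open>a\<close> and on \<open>S\<close> without \<open>b\<close>, have a combination that vanishes to one order more at
  \<open>-1\<close>. By the previous lemma its coefficient at \<open>a\<close> survives, and then so do all those on \<open>S\<close>.
\<close>

lemma ex_sparse_multiple:
  fixes S :: "nat set"
  assumes "card S = Suc e" and "S \<subseteq> {..<CHAR('k::field)}"
  shows "\<exists>h :: 'k poly. [:1, 1:] ^ e dvd h \<and> (\<forall>n. coeff h n \<noteq> 0 \<longleftrightarrow> n \<in> S)"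
  using assms
proof (induction e arbitrary: S)
  case 0
  then obtain a where "S = {a}"
    by (auto simp: card_1_singleton_iff)
  then show ?case
    by (intro exI[of _ "monom 1 a"]) auto
next
  case (Suc e)
  have fin: "finite S"
    using Suc.prems by (metis card.infinite nat.distinct(1))
  obtain a b where ab: "a \<in> S" "b \<in> S" "a \<noteq> b"
    using Suc.prems(1) by (metis card_2_iff' card_le_Suc_iff card_le_Suc0_iff_eq fin not_less_eq_eq
        Suc_le_mono zero_le)
  have "\<exists>k :: 'k poly. (\<forall>n. coeff ([:1, 1:] ^ e * k) n \<noteq> 0 \<longleftrightarrow> n \<in> S - {c})" if "c \<in> S" for c
    using Suc.IH[of "S - {c}"] Suc.prems that fin by (auto elim!: dvdE)
  from this[OF ab(1)] this[OF ab(2)] obtain k l :: "'k poly"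
    where k: "\<And>n. coeff ([:1, 1:] ^ e * k) n \<noteq> 0 \<longleftrightarrow> n \<in> S - {a}"
      and l: "\<And>n. coeff ([:1, 1:] ^ e * l) n \<noteq> 0 \<longleftrightarrow> n \<in> S - {b}"
    by blast
  have deg: "degree u < CHAR('k)" if "\<And>n. coeff u n \<noteq> 0 \<Longrightarrow> n \<in> S" for u :: "'k poly"
  proof (cases "u = 0")
    case True
    then show ?thesis
      using ab Suc.prems(2) by auto
  next
    case False
    then show ?thesis
      using that[of "degree u"] Suc.prems(2) by auto
  qed
  \<comment> \<open>If \<open>k\<close> also vanished at \<open>-1\<close>, then \<open>e + 1\<close> coefficients would be too few.\<close>
  have k0: "poly k (- 1) \<noteq> 0"
  proof
    assume "poly k (- 1) = 0"
    then have "[:1, 1:] dvd k"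
      by (simp add: poly_eq_0_iff_dvd)
    then have "[:1, 1:] ^ Suc e dvd [:1, 1:] ^ e * k"
      unfolding power_Suc2 by (rule mult_dvd_mono[OF dvd_refl])
    moreover have "degree ([:1, 1:] ^ e * k) < CHAR('k)"
      by (rule deg) (simp add: k)
    moreover have "card {n. coeff ([:1, 1:] ^ e * k) n \<noteq> 0} \<le> Suc e"
      using Suc.prems(1) ab fin unfolding k Collect_mem_eq by simp
    ultimately have "[:1, 1:] ^ e * k = 0"
      by (rule sparse_multiple_eq_0)
    then show False
      using k[of b] ab by simp
  qed
  define h where "h = [:1, 1:] ^ e * (smult (poly l (- 1)) k - smult (poly k (- 1)) l)"
  have h: "coeff h n = poly l (- 1) * coeff ([:1, 1:] ^ e * k) n
      - poly k (- 1) * coeff ([:1, 1:] ^ e * l) n" for n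
    by (simp add: h_def algebra_simps)
  have "[:1, 1:] dvd smult (poly l (- 1)) k - smult (poly k (- 1)) l"
    using poly_eq_0_iff_dvd[of "smult (poly l (- 1)) k - smult (poly k (- 1)) l" "- 1"] by simp
  then have dvd: "[:1, 1:] ^ Suc e dvd h"
    unfolding power_Suc2 h_def by (rule mult_dvd_mono[OF dvd_refl])
  have supp: "n \<in> S" if "coeff h n \<noteq> 0" for n
    using that k[of n] l[of n] by (auto simp: h)
  have "coeff h a \<noteq> 0"
    using k[of a] l[of a] k0 ab by (simp add: h)
  have "coeff h n \<noteq> 0" if n: "n \<in> S" for n
  proof
    assume "coeff h n = 0"
    then have "{n. coeff h n \<noteq> 0} \<subseteq> S - {n}"
      using supp by auto
    then have "card {n. coeff h n \<noteq> 0} \<le> card (S - {n})"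
      by (rule card_mono[rotated]) (use fin in simp)
    then have "card {n. coeff h n \<noteq> 0} \<le> Suc e"
      using Suc.prems(1) fin n by simp
    moreover have "degree h < CHAR('k)"
      by (rule deg) (rule supp)
    ultimately have "h = 0"
      by (intro sparse_multiple_eq_0[OF dvd])
    with \<open>coeff h a \<noteq> 0\<close> show False
      by simp
  qed
  with supp dvd show ?case
    by blast
qed

section \<open>Binomial coefficients and base p digits\<close>

lemma coeff_one_plus_Y_power:
  "coeff ([:1, c:] ^ n) k = of_nat (n choose k) * (c::'k::field) ^ k"
proof (cases "k \<le> n")
  case True
  then show ?thesis
    by (simp add: coeff_linear_poly_power)
next
  case False
  have "degree ([:1, c:] ^ n) \<le> n"
    using degree_power_le[of "[:1, c:]" n] by (cases "c = 0") auto
  with False show ?thesis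
    by (simp add: coeff_eq_0 binomial_eq_0)
qed

lemma one_plus_Y_power_CHAR:
  "([:1, 1:] :: 'k::field_prime_char poly) ^ CHAR('k) = 1 + monom 1 CHAR('k)"
proof -
  have "([:1, 1:] :: 'k poly) = 1 + monom 1 1"
    by (simp add: monom_altdef one_pCons)
  moreover have "(1 + monom 1 1 :: 'k poly) ^ CHAR('k) = 1 ^ CHAR('k) + monom 1 1 ^ CHAR('k)"
    by (rule freshmans_dream) (simp_all add: CHAR_prime)
  ultimately show ?thesis
    by (simp only: monom_power power_one mult_1)
qed

text \<open>
  The bound on the degree says that no coefficient of \<open>h\<close> at \<open>a + p, a + 2 p, \<dots>\<close> interferes.
\<close>

lemma coeff_mult_one_plus_monom_power:
  fixes h :: "'k::field poly"
  assumes "a < p" and "degree h < a + p"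
  shows "coeff (h * (1 + monom 1 p) ^ Q) (a + p * m) = coeff h a * of_nat (Q choose m)"
proof -
  have eq: "(1 + monom 1 p) ^ Q = (\<Sum>k\<le>Q. monom (of_nat (Q choose k) :: 'k) (p * k))"
    unfolding add.commute[of 1] binomial_ring[of "monom (1::'k) p" 1 Q]
    by (intro sum.cong refl) (simp only: power_one mult_1_right of_nat_poly monom_power, simp add: smult_monom)
  have monom: "coeff (h * monom c n) l = (if l < n then 0 else coeff h (l - n) * c)" for c n l
    unfolding mult.commute[of h "monom c n"] by (simp add: coeff_monom_mult)
  have "coeff (h * monom (of_nat (Q choose k)) (p * k)) (a + p * m) =
      (if k = m then coeff h a * of_nat (Q choose m) else 0)" for k
  proof -
    consider "k = m" | "k > m" | "k < m"
      by linarith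
    then show ?thesis
    proof cases
      case 1
      then show ?thesis
        by (simp add: monom)
    next
      case 2
      then have "p * Suc m \<le> p * k"
        by (intro mult_le_mono2) simp
      then have "a + p * m < p * k"
        using assms(1) by simp
      with 2 show ?thesis
        by (simp add: monom)
    next
      case 3
      then have "p * Suc k \<le> p * m"
        by (intro mult_le_mono2) simp
      then have "a + p \<le> a + p * m - p * k"
        using assms(1) by simp
      with assms(2) have "coeff h (a + p * m - p * k) = 0"
        by (intro coeff_eq_0) linarith
      with 3 show ?thesis
        by (simp add: monom)
    qed
  qed
  then show ?thesis
    by (simp add: eq sum_distrib_left coeff_sum binomial_eq_0)
qed

lemma degree_one_plus_Y_power [simp]: "degree ([:1, 1:] ^ n :: 'k::field poly) = n"
  by (simp add: degree_power_eq)

lemma one_plus_Y_power_digits: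
  fixes n :: nat
  defines "p \<equiv> CHAR('k::field_prime_char)"
  shows "([:1, 1:] :: 'k poly) ^ n = [:1, 1:] ^ (n mod p) * (1 + monom 1 p) ^ (n div p)"
  using mult_div_mod_eq[of p n] unfolding p_def one_plus_Y_power_CHAR[symmetric]
  by (metis add.commute power_add power_mult)

text \<open>
  Lucas' congruence, stated in a field of characteristic \<open>p\<close>: compare coefficients in the factorization
  of the previous lemma.
\<close>

lemma binomial_Lucas:
  fixes n m :: nat
  defines "p \<equiv> CHAR('k::field_prime_char)"
  shows "(of_nat (n choose m) :: 'k)
    = of_nat (n mod p choose (m mod p)) * of_nat (n div p choose (m div p))"
proof -
  have p: "p > 0"
    unfolding p_def by simp
  have "(of_nat (n choose m) :: 'k) = coeff ([:1, 1:] ^ n) m"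
    by (simp add: coeff_one_plus_Y_power)
  also have "\<dots> = coeff ([:1, 1:] ^ (n mod p) * (1 + monom 1 p) ^ (n div p)) (m mod p + p * (m div p))"
    unfolding p_def one_plus_Y_power_digits[symmetric] by simp
  also have "\<dots> = coeff ([:1, 1:] ^ (n mod p)) (m mod p) * of_nat (n div p choose (m div p))"
  proof (rule coeff_mult_one_plus_monom_power)
    show "degree ([:1, 1:] ^ (n mod p) :: 'k poly) < m mod p + p"
      using p by (simp add: trans_less_add2)
  qed (use p in simp)
  finally show ?thesis
    by (simp add: coeff_one_plus_Y_power)
qed

lemma of_nat_binomial_small_neq_0:
  assumes "k \<le> n" and "n < CHAR('k::field_prime_char)"
  shows "(of_nat (n choose k) :: 'k) \<noteq> 0"
proof
  have prime: "prime CHAR('k)"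
    by (rule CHAR_prime)
  assume "(of_nat (n choose k) :: 'k) = 0"
  then have "CHAR('k) dvd n choose k"
    by (simp add: of_nat_eq_0_iff_char_dvd)
  then have "CHAR('k) dvd fact n"
    using binomial_fact_lemma[OF assms(1)] by (metis dvd_mult)
  then show False
    using assms(2) prime by (simp add: prime_dvd_fact_iff)
qed

lemma digit_sum_less [simp]: "a < p \<Longrightarrow> digit_sum p a = a"
proof -
  assume a: "a < p"
  have "a div p ^ n mod p = 0" if "n > 0" for n
  proof -
    have "p ^ 1 \<le> p ^ n"
      by (rule power_increasing) (use a that in auto)
    then show ?thesis
      using a by simp
  qed
  then have "(\<Sum>n\<le>a. a div p ^ n mod p) = (\<Sum>n\<le>a. if n = 0 then a else 0)"
    using a by (intro sum.cong) auto
  then show ?thesis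
    by (simp add: digit_sum_def base_digit_def)
qed

lemma digit_sum_rec:
  assumes "p \<ge> 2"
  shows "digit_sum p a = a mod p + digit_sum p (a div p)"
proof (cases "a = 0")
  case False
  define b where "b = a div p"
  have "b < a"
    using False assms by (simp add: b_def)
  have zero: "b div p ^ n mod p = 0" if "n > b" for n
  proof -
    have "n < p ^ n"
      using assms by (simp add: power_gt_expt)
    with that have "b < p ^ n"
      by simp
    then show ?thesis
      by simp
  qed
  have "digit_sum p a = (\<Sum>n<Suc a. a div p ^ n mod p)"
    unfolding digit_sum_def base_digit_def lessThan_Suc_atMost ..
  also have "\<dots> = a mod p + (\<Sum>n<a. b div p ^ n mod p)"
    by (subst sum.lessThan_Suc_shift) (simp add: b_def div_mult2_eq)
  also have "(\<Sum>n<a. b div p ^ n mod p) = (\<Sum>n\<le>b. b div p ^ n mod p)"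
    by (rule sum.mono_neutral_right) (use \<open>b < a\<close> zero in auto)
  finally show ?thesis
    by (simp add: digit_sum_def base_digit_def b_def)
qed (use assms in simp)

lemma digit_sum_eq_0:
  assumes "p \<ge> 2" and "digit_sum p a = 0"
  shows "a = 0"
  using assms(2)
proof (induction a rule: less_induct)
  case (less a)
  show ?case
  proof (rule ccontr)
    assume "a \<noteq> 0"
    then have "a div p < a"
      using assms(1) by simp
    then have "a div p = 0"
      by (rule less.IH) (use less.prems in \<open>simp add: digit_sum_rec[OF assms(1), of a]\<close>)
    moreover have "a mod p = 0"
      using less.prems by (simp add: digit_sum_rec[OF assms(1), of a])
    ultimately show False
      using \<open>a \<noteq> 0\<close> by (metis div_mult_mod_eq add_0 mult_0)
  qed
qed

text \<open>
  Casting out nines in base \<open>p\<close>. It converts the torus weight of an exponent, which is its residue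
  modulo \<open>p - 1\<close>, into a statement on digits.
\<close>

lemma digit_sum_mod:
  assumes "p \<ge> 2"
  shows "digit_sum p a mod (p - 1) = a mod (p - 1)"
proof (induction a rule: less_induct)
  case (less a)
  show ?case
  proof (cases "a < p")
    case False
    have "digit_sum p (a div p) mod (p - 1) = a div p mod (p - 1)"
      by (rule less) (use assms False in auto)
    then have "digit_sum p a mod (p - 1) = (a mod p + a div p) mod (p - 1)"
      unfolding digit_sum_rec[OF assms, of a] by (rule mod_add_cong[OF refl])
    also have "\<dots> = (a mod p + a div p + (p - 1) * (a div p)) mod (p - 1)"
      by simp
    also have "a mod p + a div p + (p - 1) * (a div p) = a"
    proof -
      have "a div p + (p - 1) * (a div p) = p * (a div p)"
        using assms by (cases p) auto
      then show ?thesis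
        by (metis add.assoc mod_mult_div_eq)
    qed
    finally show ?thesis .
  qed simp
qed

lemma digit_sum_Suc_le:
  assumes "p \<ge> 2"
  shows "digit_sum p (Suc a) \<le> Suc (digit_sum p a)"
proof (induction a rule: less_induct)
  case (less a)
  show ?case
  proof (cases "Suc (a mod p) = p")
    case True
    then have eq: "Suc a mod p = 0" "Suc a div p = Suc (a div p)"
      by (simp_all add: mod_Suc div_Suc)
    have "a > 0"
      using True assms by (cases a) auto
    then have "digit_sum p (Suc (a div p)) \<le> Suc (digit_sum p (a div p))"
      using assms by (intro less) simp
    then show ?thesis
      using digit_sum_rec[OF assms, of "Suc a"] digit_sum_rec[OF assms, of a] eq by simp
  next
    case False
    then have "Suc a mod p = Suc (a mod p)" "Suc a div p = a div p"
      by (simp_all add: mod_Suc div_Suc)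
    then show ?thesis
      using digit_sum_rec[OF assms, of "Suc a"] digit_sum_rec[OF assms, of a] by simp
  qed
qed

text \<open>
  By Lucas, a binomial coefficient is nonzero modulo \<open>p\<close> if and only if every digit of \<open>m\<close> is at most
  the corresponding digit of \<open>n\<close>. This lemma and the next one extract what that means for digit sums.
\<close>

lemma digit_sum_le_of_binomial_neq_0:
  assumes "(of_nat (n choose m) :: 'k::field_prime_char) \<noteq> 0"
  shows "digit_sum CHAR('k) m \<le> digit_sum CHAR('k) n"
  using assms
proof (induction n arbitrary: m rule: less_induct)
  case (less n)
  define p where "p = CHAR('k)"
  have p: "p \<ge> 2"
    unfolding p_def using CHAR_prime prime_ge_2_nat by blast
  show ?case
  proof (cases "n = 0")
    case True
    with less.prems show ?thesis
      by (cases m) auto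
  next
    case False
    have ne: "(of_nat (n mod p choose (m mod p)) :: 'k) \<noteq> 0"
        "(of_nat (n div p choose (m div p)) :: 'k) \<noteq> 0"
      using less.prems binomial_Lucas[where ?'k = 'k, of n m] by (auto simp: p_def)
    from ne(1) have "m mod p \<le> n mod p"
      by (metis binomial_eq_0 not_le of_nat_0)
    moreover have "digit_sum p (m div p) \<le> digit_sum p (n div p)"
      unfolding p_def by (rule less.IH) (use ne(2) False p in \<open>auto simp: p_def\<close>)
    ultimately show ?thesis
      unfolding p_def[symmetric] digit_sum_rec[OF p, of m] digit_sum_rec[OF p, of n] by simp
  qed
qed

lemma ex_binomial_neq_0_digit_sum:
  assumes "d \<le> digit_sum CHAR('k::field_prime_char) n"
  shows "\<exists>m. (of_nat (n choose m) :: 'k) \<noteq> 0 \<and> digit_sum CHAR('k) m = d"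
  using assms
proof (induction n arbitrary: d rule: less_induct)
  case (less n)
  define p where "p = CHAR('k)"
  have p: "p \<ge> 2"
    unfolding p_def using CHAR_prime prime_ge_2_nat by blast
  show ?case
  proof (cases "n = 0")
    case True
    with less.prems p show ?thesis
      by (intro exI[of _ 0]) (simp add: p_def)
  next
    case False
    define d0 where "d0 = min d (n mod p)"
    have "d - d0 \<le> digit_sum p (n div p)"
      using less.prems digit_sum_rec[OF p, of n] unfolding d0_def p_def[symmetric] by simp
    then obtain m where m: "(of_nat (n div p choose m) :: 'k) \<noteq> 0" "digit_sum p m = d - d0"
      using less.IH[of "n div p"] False p unfolding p_def[symmetric] by auto
    define m' where "m' = d0 + p * m"
    have d0: "d0 \<le> n mod p" "d0 \<le> d" "n mod p < p"
      using p by (simp_all add: d0_def)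
    then have "d0 < p"
      by linarith
    then have eq: "m' mod p = d0" "m' div p = m"
      by (simp_all add: m'_def)
    have "(of_nat (n mod p choose d0) :: 'k) \<noteq> 0"
      using d0 by (intro of_nat_binomial_small_neq_0) (simp_all add: p_def)
    then have "(of_nat (n choose m') :: 'k) \<noteq> 0"
      using m(1) binomial_Lucas[where ?'k = 'k, of n m'] eq unfolding p_def[symmetric] by simp
    moreover have "digit_sum p m' = d"
      using digit_sum_rec[OF p, of m'] eq m(2) d0 by simp
    ultimately show ?thesis
      unfolding p_def[symmetric] by blast
  qed
qed

section \<open>Isolated coefficients in multiples of powers of 1 + Y\<close>

text \<open>
  The necessity half of the one-variable problem. Let \<open>N\<^sub>0\<close> be the last digit of \<open>N\<close>, and let
  \<open>z = D + 1 - N\<^sub>0\<close> with \<open>D = min (p - 1) (N\<^sub>0 + j)\<close>. If the digit sum of \<open>N\<close> were too large, then the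
  exponents \<open>i - d + p m\<close>, with \<open>m\<close> of digit sum \<open>d\<close>, would force the coefficients of
  \<open>h = (1 + Y)\<^bsup>N\<^sub>0\<^esup> A\<close> at \<open>i - 1, \<dots>, i - z\<close> to vanish. Since \<open>h\<close> can have degree \<open>p\<close> or more, it is
  replaced by its remainder modulo \<open>(1 + Y)\<^sup>p = 1 + Y\<^sup>p\<close>, which remains divisible by \<open>(1 + Y)\<^bsup>N\<^sub>0\<^esup>\<close>. This
  remainder has too few nonzero coefficients, although its coefficient at \<open>i\<close> is \<open>1\<close>.
\<close>

lemma degree_bound_of_isolated_coeff:
  fixes A :: "'k::field_prime_char poly"
  defines "p \<equiv> CHAR('k)"
  assumes "degree A \<le> j" and "j < i" and "i \<le> p - 1" and "i < N"
    and isolated: "\<And>n. n mod (p - 1) = i mod (p - 1) \<Longrightarrow> j < n \<Longrightarrow> n < N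
      \<Longrightarrow> coeff ([:1, 1:] ^ N * A) n = (if n = i then 1 else 0)"
  shows "i \<le> N mod p + j \<and> digit_sum p N \<le> min (p - 1) (N mod p + j)"
proof -
  have p: "p \<ge> 2"
    unfolding p_def using CHAR_prime prime_ge_2_nat by blast
  define N0 Q D where "N0 = N mod p" and "Q = N div p" and "D = min (p - 1) (N0 + j)"
  define h where "h = [:1, 1:] ^ N0 * A"
  have N0: "N0 < p" and N: "N = N0 + p * Q"
    using p by (simp_all add: N0_def Q_def)
  have "degree h \<le> N0 + j"
    unfolding h_def using degree_mult_le[of "[:1, 1:] ^ N0" A] assms(2) by simp
  then have h_zero: "coeff h n = 0" if "n > N0 + j" for n
    using that by (intro coeff_eq_0) simp
  have "[:1, 1:] ^ N * A = h * (1 + monom 1 p) ^ Q"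
    unfolding h_def N0_def Q_def p_def one_plus_Y_power_digits[of N] by (simp add: mult_ac)
  then have coeff: "coeff ([:1, 1:] ^ N * A) (a + p * m) = coeff h a * of_nat (Q choose m)"
    if "a < p" "N0 + j < a + p" for a m
    using coeff_mult_one_plus_monom_power[of a p h Q m] that \<open>degree h \<le> N0 + j\<close> by simp
  have "coeff h i = 1"
    using coeff[of i 0] isolated[of i] assms N0 by simp
  with h_zero[of i] have i: "i \<le> N0 + j"
    by (metis not_le zero_neq_one)
  moreover have "digit_sum p N \<le> D"
  proof (rule ccontr)
    \<comment> \<open>So many zeros below \<open>i\<close> leave only \<open>N\<^sub>0\<close> of the positions \<open>0, \<dots>, D\<close>.\<close>
    define z where "z = Suc D - N0"
    have z: "z \<le> Suc j" "N0 + z = Suc D" "1 \<le> z"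
      using N0 by (auto simp: z_def D_def)
    have iD: "i \<le> D"
      using i assms(4) by (simp add: D_def)
    assume "\<not> digit_sum p N \<le> D"
    then have zQ: "z \<le> digit_sum p Q"
      unfolding z_def by (simp add: digit_sum_rec[OF p, of N] N0_def Q_def)
    have zero: "coeff h (i - d) = 0 \<and> coeff h (i - d + p) = 0" if d: "1 \<le> d" "d \<le> z" for d
    proof -
      have "d \<le> digit_sum p Q"
        using d zQ by simp
      then obtain m where m: "(of_nat (Q choose m) :: 'k) \<noteq> 0" "digit_sum p m = d"
        unfolding p_def using ex_binomial_neq_0_digit_sum[where ?'k = 'k] by blast
      define n where "n = i - d + p * m"
      have di: "d \<le> i"
        using d z assms(3) by linarith
      have a: "i - d < p"
        using assms(4) p by linarith
      have "m \<le> Q"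
        using m(1) by (metis binomial_eq_0 not_le of_nat_0)
      have "m \<noteq> 0"
        using m(2) d(1) by (metis digit_sum_less p not_one_le_zero less_le_trans pos2)
      then have "p \<le> n"
        by (cases m) (auto simp: n_def)
      \<comment> \<open>Only \<open>m = Q\<close> could lead out of the range below \<open>N\<close>; then \<open>d = z\<close> and
         \<open>i - z < N\<^sub>0\<close>.\<close>
      have "n < N"
      proof (cases "m = Q")
        case True
        then have "d = z"
          using m(2) zQ d by simp
        then have "i - d < N0"
          using iD z N0 di d by linarith
        with True show ?thesis
          by (simp add: n_def N)
      next
        case False
        then have "p * Suc m \<le> p * Q"
          using \<open>m \<le> Q\<close> by (intro mult_le_mono2) simp
        then show ?thesis
          using a by (simp add: n_def N)
      qed
      have "n mod (p - 1) = digit_sum p n mod (p - 1)"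
        by (simp only: digit_sum_mod[OF p])
      also have "digit_sum p n = i - d + d"
        using digit_sum_rec[OF p, of n] a m(2) by (simp add: n_def)
      finally have "n mod (p - 1) = i mod (p - 1)"
        using di by simp
      then have "coeff ([:1, 1:] ^ N * A) n = 0"
        using isolated[of n] \<open>p \<le> n\<close> \<open>n < N\<close> assms(3,4) p by auto
      \<comment> \<open>No wrap-around: \<open>h\<close> has no coefficient at \<open>i - d + p\<close>.\<close>
      moreover have "N0 + j < i - d + p"
      proof (cases "D = p - 1")
        case True
        then show ?thesis
          using d z di assms(3) N0 iD by linarith
      next
        case False
        then show ?thesis
          using p by (simp add: D_def min_def split: if_splits)
      qed
      ultimately show ?thesis
        using coeff[OF a] m(1) h_zero unfolding n_def by simp
    qed
    \<comment> \<open>The remainder of \<open>h\<close> modulo \<open>1 + Y\<^sup>p\<close>, because the degree of \<open>h\<close> is less than \<open>2 p\<close>.\<close>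
    define g where "g = h - (1 + monom 1 p) * poly_shift p h"
    have g: "coeff g n = (if n < p then coeff h n - coeff h (n + p) else - coeff h (n + p))" for n
      by (simp add: g_def algebra_simps coeff_monom_mult coeff_poly_shift)
    have supp: "n \<in> {..D} - {i - z..<i}" if n: "coeff g n \<noteq> 0" for n
    proof -
      have "n < p"
        using n N0 assms(3,4) h_zero[of "n + p"] by (cases "n < p") (auto simp: g)
      moreover have "n \<le> D"
        using \<open>n < p\<close> n h_zero[of n] h_zero[of "n + p"] by (fastforce simp: D_def g not_less)
      moreover have "n \<notin> {i - z..<i}"
        using zero[of "i - n"] n \<open>n < p\<close> z by (auto simp: g)
      ultimately show ?thesis
        by simp
    qed
    have "[:1, 1:] ^ N0 dvd g"
    proof -
      have "[:1, 1:] ^ N0 dvd (1 + monom 1 p :: 'k poly)"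
        unfolding p_def one_plus_Y_power_CHAR[symmetric]
        using N0 by (intro le_imp_power_dvd) (simp add: p_def)
      then show ?thesis
        unfolding g_def h_def by (intro dvd_diff dvd_triv_left dvd_mult2)
    qed
    moreover have "degree g < CHAR('k)"
    proof (cases "g = 0")
      case False
      then show ?thesis
        using supp[of "degree g"] p by (auto simp: D_def p_def)
    qed (use p in \<open>simp add: p_def\<close>)
    moreover have "card {n. coeff g n \<noteq> 0} \<le> N0"
    proof -
      have "card {n. coeff g n \<noteq> 0} \<le> card ({..D} - {i - z..<i})"
        using supp by (intro card_mono) auto
      also have "\<dots> = Suc D - z"
        using iD z assms(3) by (subst card_Diff_subset) auto
      finally show ?thesis
        using z by simp
    qed
    ultimately have "g = 0"
      by (rule sparse_multiple_eq_0)
    moreover have "coeff g i = 1"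
      using g[of i] \<open>coeff h i = 1\<close> h_zero[of "i + p"] N0 assms(3,4) p by simp
    ultimately show False
      by simp
  qed
  ultimately show ?thesis
    by (simp add: D_def N0_def)
qed

text \<open>
  The sufficiency half. With \<open>D = min (p - 1) (N\<^sub>0 + j)\<close>, take for \<open>h\<close> the multiple of
  \<open>(1 + Y)\<^bsup>N\<^sub>0\<^esup>\<close> supported on \<open>{0..D}\<close> without the \<open>D - N\<^sub>0\<close> positions just below \<open>i\<close>; what remains
  are exactly \<open>N\<^sub>0 + 1\<close> positions.
\<close>

lemma ex_multiple_with_isolated_coeff:
  fixes i j N :: nat
  defines "p \<equiv> CHAR('k::field_prime_char)"
  assumes "j < i" and "i \<le> p - 1" and "i \<le> N mod p + j"
    and "digit_sum p N \<le> min (p - 1) (N mod p + j)"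
  shows "\<exists>A :: 'k poly. degree A \<le> j \<and> coeff ([:1, 1:] ^ N * A) i \<noteq> 0 \<and>
    (\<forall>n. n mod (p - 1) = i mod (p - 1) \<longrightarrow> j < n \<longrightarrow> n \<noteq> i \<longrightarrow> coeff ([:1, 1:] ^ N * A) n = 0)"
proof -
  have p: "p \<ge> 2"
    unfolding p_def using CHAR_prime prime_ge_2_nat by blast
  define N0 Q D where "N0 = N mod p" and "Q = N div p" and "D = min (p - 1) (N0 + j)"
  have N0: "N0 < p"
    using p by (simp_all add: N0_def)
  have z: "D - N0 \<le> j" "N0 \<le> D" "i \<le> D" "D < p"
    using N0 assms(3,4) p unfolding D_def N0_def[symmetric] by auto
  have Q: "digit_sum p Q \<le> D - N0"
    using assms(5) unfolding digit_sum_rec[OF p, of N] N0_def[symmetric] Q_def[symmetric] D_def[symmetric]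
    by simp
  define S where "S = {..D} - {i - (D - N0)..<i}"
  have "card S = Suc D - (D - N0)"
    using z assms(2) unfolding S_def by (subst card_Diff_subset) auto
  then have "card S = Suc N0"
    using z by simp
  moreover have "S \<subseteq> {..<CHAR('k)}"
    using z by (auto simp: S_def p_def)
  ultimately obtain h :: "'k poly"
    where "[:1, 1:] ^ N0 dvd h" and h: "\<And>n. coeff h n \<noteq> 0 \<longleftrightarrow> n \<in> S"
    using ex_sparse_multiple[of S N0, where ?'k = 'k] by blast
  then obtain A where A: "h = [:1, 1:] ^ N0 * A"
    by (elim dvdE)
  have iS: "i \<in> S"
    using z by (simp add: S_def)
  then have "h \<noteq> 0"
    using h by force
  then have "degree h \<in> S"
    using h[of "degree h"] by simp
  then have deg: "degree h \<le> D"
    by (simp add: S_def)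
  have "degree h = N0 + degree A"
    using \<open>h \<noteq> 0\<close> unfolding A by (subst degree_mult_eq) auto
  then have "degree A \<le> j"
    using deg by (simp add: D_def)
  moreover have "[:1, 1:] ^ N * A = h * (1 + monom 1 p) ^ Q"
    unfolding A N0_def Q_def p_def one_plus_Y_power_digits[of N] by (simp add: mult_ac)
  then have coeff: "coeff ([:1, 1:] ^ N * A) (a + p * m) = coeff h a * of_nat (Q choose m)"
    if "a < p" for a m
    using coeff_mult_one_plus_monom_power[of a p h Q m] that deg z by simp
  have "coeff ([:1, 1:] ^ N * A) i \<noteq> 0"
    using coeff[of i 0] iS h[of i] z by simp
  moreover have "coeff ([:1, 1:] ^ N * A) n = 0"
    if n: "n mod (p - 1) = i mod (p - 1)" "j < n" "n \<noteq> i" for n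
  proof (rule ccontr)
    define a m d where "a = n mod p" and "m = n div p" and "d = digit_sum p m"
    assume "coeff ([:1, 1:] ^ N * A) n \<noteq> 0"
    moreover have a: "a < p" "n = a + p * m"
      using p by (simp_all add: a_def m_def)
    ultimately have "a \<in> S" and m: "(of_nat (Q choose m) :: 'k) \<noteq> 0"
      using coeff[of a m] h[of a] by auto
    have d: "d \<le> D - N0"
      using digit_sum_le_of_binomial_neq_0[OF m] Q unfolding d_def p_def by simp
    then have di: "d < i"
      using z assms(2) by simp
    have "n mod (p - 1) = digit_sum p n mod (p - 1)"
      by (simp only: digit_sum_mod[OF p])
    also have "digit_sum p n = a + d"
      using digit_sum_rec[OF p, of n] by (simp add: a_def m_def d_def)
    finally have "[a + d = (i - d) + d] (mod (p - 1))"
      using n(1) di by (simp add: cong_def)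
    then have cong: "a mod (p - 1) = (i - d) mod (p - 1)"
      by (simp only: cong_add_rcancel_nat) (simp only: cong_def)
    \<comment> \<open>For \<open>d > 0\<close> the congruence forces \<open>a = i - d\<close>, a position left out of \<open>S\<close>. For \<open>d = 0\<close> we
       have \<open>n = a\<close> in the range from \<open>1\<close> to \<open>p - 1\<close>, where residues modulo \<open>p - 1\<close> are distinct.\<close>
    show False
    proof (cases "d = 0")
      case True
      then have "n = a"
        using digit_sum_eq_0[OF p, of m] a by (simp add: d_def)
      have "x = p - 1 \<longleftrightarrow> x mod (p - 1) = 0" if "0 < x" "x \<le> p - 1" for x
        using that by (auto dest: dvd_imp_le)
      then have "n = i"
        using n(1,2) \<open>n = a\<close> a(1) assms(2,3)
        by (metis One_nat_def Suc_pred' le_neq_implies_less less_Suc_eq_le mod_less not_less0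
            gr0I less_nat_zero_code)
      with n(3) show False ..
    next
      case False
      then have less: "i - d < p - 1"
        using assms(3) di by linarith
      then have "a mod (p - 1) = i - d"
        using cong by simp
      with di a(1) have "a = i - d"
        by (cases "a = p - 1") auto
      then show False
        using \<open>a \<in> S\<close> d False di by (auto simp: S_def)
    qed
  qed
  ultimately show ?thesis
    by blast
qed

section \<open>The action as a ring homomorphism\<close>

lemma comm_ring_hom_poly_map_poly:
  fixes h :: "'a::comm_ring_1 \<Rightarrow> 'b::comm_ring_1"
  assumes "comm_ring_hom h"
  shows "comm_ring_hom (\<lambda>q. poly (map_poly h q) x)"
proof -
  interpret h: comm_ring_hom h
    by (rule assms)
  interpret map_poly_comm_ring_hom h
    by unfold_locales
  show ?thesis
    by unfold_locales (simp_all add: hom_distribs)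
qed

lemma bsubst_eq_poly:
  "bsubst F P Q = poly (map_poly (\<lambda>q. poly (map_poly bconst q) P) F) Q"
proof -
  have 0: "bconst (0 :: 'a) = 0"
    by (simp add: bconst_def)
  have "poly (map_poly bconst q) P = (\<Sum>m\<le>degree q. bscale (coeff q m) (P ^ m))" for q :: "'a poly"
    using eval_poly_as_sum[of bconst q P, OF 0] by (simp add: eval_poly_def bscale_def mult.commute)
  moreover have "poly (map_poly (\<lambda>q. poly (map_poly bconst q) P) F) Q
      = (\<Sum>n\<le>degree F. Q ^ n * poly (map_poly bconst (coeff F n)) P)"
    using eval_poly_as_sum[of "\<lambda>q. poly (map_poly bconst q) P" F Q] by (simp add: eval_poly_def)
  ultimately show ?thesis
    by (simp add: bsubst_def sum_distrib_left bscale_def mult_ac)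
qed

lemma comm_ring_hom_gl2_act: "comm_ring_hom (gl2_act A)"
proof -
  have "comm_ring_hom (bconst :: 'a \<Rightarrow> 'a poly poly)"
    by unfold_locales (simp_all add: bconst_def one_pCons)
  from comm_ring_hom_poly_map_poly[OF comm_ring_hom_poly_map_poly[OF this]]
  show ?thesis
    unfolding gl2_act_def bsubst_eq_poly .
qed

interpretation gl2_act: comm_ring_hom "gl2_act A" for A :: "'k::field ^ 2 ^ 2"
  by (rule comm_ring_hom_gl2_act)

lemma gl2_act_bscale: "gl2_act A (bscale c F) = bscale c (gl2_act A F)"
proof -
  have "gl2_act A (bconst c) = bconst c"
    by (simp add: gl2_act_def bsubst_def bconst_def bscale_def)
  then show ?thesis
    by (simp add: bscale_def gl2_act.hom_mult)
qed

text \<open>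
  The actions are ring homomorphisms, so this reduces to \<open>X\<close> and \<open>Y\<close>, where it is the definition of
  the matrix product.
\<close>

lemma gl2_act_comp_monomial:
  "gl2_act B (gl2_act A (bvar_X ^ a * bvar_Y ^ b)) = gl2_act (B ** A) (bvar_X ^ a * bvar_Y ^ b)"
proof -
  have X: "gl2_act C bvar_X = bscale (C $ 1 $ 1) bvar_X + bscale (C $ 2 $ 1) bvar_Y"
    and Y: "gl2_act C bvar_Y = bscale (C $ 1 $ 2) bvar_X + bscale (C $ 2 $ 2) bvar_Y" for C :: "'a ^ 2 ^ 2"
    using gl2_act_monomial[of C 1 0] gl2_act_monomial[of C 0 1] by simp_all
  have "gl2_act B (gl2_act A bvar_X) = gl2_act (B ** A) bvar_X"
    "gl2_act B (gl2_act A bvar_Y) = gl2_act (B ** A) bvar_Y"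
    unfolding X Y gl2_act.hom_add gl2_act_bscale
    by (simp_all add: matrix_matrix_mult_def sum_2 bivar.scale_right_distrib bivar.scale_left_distrib
        mult.commute add_ac)
  then show ?thesis
    by (simp add: gl2_act.hom_mult gl2_act.hom_power)
qed

definition dehomogenize :: "'k::field poly poly \<Rightarrow> 'k poly" where
  "dehomogenize F = map_poly (\<lambda>q. poly q 1) F"

lemma coeff_dehomogenize: "coeff (dehomogenize F) n = poly (coeff F n) 1"
  by (simp add: dehomogenize_def coeff_map_poly)

interpretation dehomogenize: comm_ring_hom "dehomogenize :: 'k::field poly poly \<Rightarrow> 'k poly"
proof -
  interpret map_poly_comm_ring_hom "\<lambda>q :: 'k poly. poly q 1"
    by unfold_locales simp_all
  show "comm_ring_hom (dehomogenize :: 'k poly poly \<Rightarrow> 'k poly)"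
    unfolding dehomogenize_def by unfold_locales
qed

lemma dehomogenize_bscale: "dehomogenize (bscale c F) = smult c (dehomogenize F)"
  by (simp add: dehomogenize_def bscale_def bconst_def poly_eq_iff coeff_map_poly)

lemma dehomogenize_linear: "dehomogenize (bscale a bvar_X + bscale b bvar_Y) = [:a, b:]"
  by (simp add: poly_eq_iff coeff_dehomogenize bscale_def bconst_def bvar_X_def bvar_Y_def
      coeff_pCons split: nat.splits)

lemma dehomogenize_monomial: "dehomogenize (bvar_X ^ a * bvar_Y ^ b) = monom 1 b"
  unfolding bvar_monomial by (simp add: poly_eq_iff coeff_dehomogenize poly_monom)

definition homogenize :: "nat \<Rightarrow> 'k::field poly \<Rightarrow> 'k poly poly" where
  "homogenize r g = (\<Sum>n\<le>r. bscale (coeff g n) (bvar_X ^ (r - n) * bvar_Y ^ n))"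

lemma homogenize_add: "homogenize r (f + g) = homogenize r f + homogenize r g"
  by (simp add: homogenize_def bivar.scale_left_distrib sum.distrib)

lemma homogenize_smult: "homogenize r (smult c g) = bscale c (homogenize r g)"
  by (simp add: homogenize_def bivar.scale_sum_right)

lemma homogenize_0: "homogenize r 0 = 0"
  by (simp add: homogenize_def)

lemma homogenize_sum: "homogenize r (sum f S) = (\<Sum>x\<in>S. homogenize r (f x))"
  by (induction S rule: infinite_finite_induct) (simp_all add: homogenize_add homogenize_0)

lemma homogenize_monom:
  assumes "n \<le> r"
  shows "homogenize r (monom c n) = bscale c (bvar_X ^ (r - n) * bvar_Y ^ n)"
proof -
  have "homogenize r (monom c n)
      = (\<Sum>m\<le>r. if m = n then bscale c (bvar_X ^ (r - n) * bvar_Y ^ n) else 0)"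
    unfolding homogenize_def by (intro sum.cong) auto
  then show ?thesis
    using assms by simp
qed

text \<open>
  For \<open>a + b = r\<close> this is the image of a monomial under \<open>X \<mapsto> X + Y\<close>, and for \<open>b = 0\<close> the image of a
  monomial under \<open>Y \<mapsto> X + Y\<close>.
\<close>

lemma homogenize_linear_power:
  assumes "a + b \<le> r"
  shows "homogenize r ([:1, 1:] ^ a * monom 1 b)
    = bvar_X ^ (r - a - b) * (bvar_X + bvar_Y) ^ a * (bvar_Y ^ b :: 'k::field poly poly)"
proof -
  have of_nat: "bscale (of_nat n) F = of_nat n * F" for n and F :: "'k poly poly"
    by (simp add: bscale_def bconst_def of_nat_poly)
  have "[:1, 1:] ^ a * monom 1 b = (\<Sum>k\<le>a. monom (of_nat (a choose k)) (k + b) :: 'k poly)"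
  proof (rule poly_eqI)
    fix n
    have "coeff (\<Sum>k\<le>a. monom (of_nat (a choose k)) (k + b) :: 'k poly) n
        = (\<Sum>k\<le>a. if k + b = n then of_nat (a choose k) else 0)"
      by (simp add: coeff_sum)
    also have "\<dots> = (if n < b then 0 else of_nat (a choose (n - b)))"
    proof (cases "n < b")
      case False
      then obtain m where "n = m + b"
        by (metis add.commute le_Suc_ex not_less)
      then show ?thesis
        by (simp add: binomial_eq_0)
    qed auto
    finally show "coeff ([:1, 1:] ^ a * monom 1 b :: 'k poly) n
        = coeff (\<Sum>k\<le>a. monom (of_nat (a choose k)) (k + b)) n"
      unfolding mult.commute[of "[:1, 1:] ^ a"]
      by (simp add: coeff_monom_mult coeff_one_plus_Y_power)
  qed
  then have "homogenize r ([:1, 1:] ^ a * monom 1 b)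
      = (\<Sum>k\<le>a. of_nat (a choose k) * (bvar_X ^ (r - (k + b)) * bvar_Y ^ (k + b)) :: 'k poly poly)"
    using assms by (simp add: homogenize_sum homogenize_monom of_nat)
  also have "\<dots> = bvar_X ^ (r - a - b) * (\<Sum>k\<le>a. of_nat (a choose k) * bvar_Y ^ k * bvar_X ^ (a - k))
      * bvar_Y ^ b"
    unfolding sum_distrib_left sum_distrib_right
  proof (intro sum.cong refl)
    fix k
    assume "k \<in> {..a}"
    then have "r - (k + b) = (r - a - b) + (a - k)"
      using assms by auto
    then show "of_nat (a choose k) * (bvar_X ^ (r - (k + b)) * bvar_Y ^ (k + b)) =
        bvar_X ^ (r - a - b) * (of_nat (a choose k) * bvar_Y ^ k * bvar_X ^ (a - k))
          * (bvar_Y ^ b :: 'k poly poly)"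
      by (simp add: power_add mult_ac)
  qed
  also have "(\<Sum>k\<le>a. of_nat (a choose k) * bvar_Y ^ k * bvar_X ^ (a - k) :: 'k poly poly)
      = (bvar_X + bvar_Y) ^ a"
    by (simp add: binomial_ring[of bvar_Y] add.commute[of bvar_X])
  finally show ?thesis .
qed

section \<open>Projection to the weight spaces of the torus\<close>

lemma mod_ring_power_card_minus_1:
  fixes c :: "'p::prime_card mod_ring"
  assumes "c \<noteq> 0"
  shows "c ^ (CARD('p) - 1) = 1"
proof -
  have "c * c ^ (CARD('p) - 1) = c ^ CARD('p)"
    by (metis finite_UNIV_card_ge_0 finite power_eq_if not_gr0)
  also have "\<dots> = c * 1"
    using finite_field_power_card_eq_same[of c] by simp
  finally show ?thesis
    using assms by simp
qed

lemma mod_ring_power_cong: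
  fixes c :: "'p::prime_card mod_ring"
  assumes "c \<noteq> 0" and "m mod (CARD('p) - 1) = n mod (CARD('p) - 1)"
  shows "c ^ m = c ^ n"
proof -
  have "c ^ k = c ^ (k mod (CARD('p) - 1))" for k
  proof -
    have "c ^ k = c ^ ((CARD('p) - 1) * (k div (CARD('p) - 1)) + k mod (CARD('p) - 1))"
      by simp
    also have "\<dots> = c ^ (k mod (CARD('p) - 1))"
      by (simp only: power_add power_mult mod_ring_power_card_minus_1[OF assms(1)] power_one mult_1)
    finally show ?thesis .
  qed
  from this[of m] this[of n] assms(2) show ?thesis
    by metis
qed

text \<open>
  When \<open>p - 1\<close> does not divide \<open>m\<close>, counting roots yields some \<open>c \<noteq> 0\<close> with \<open>c\<^sup>m \<noteq> 1\<close>, and the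
  substitution \<open>x \<mapsto> c x\<close> multiplies the sum by \<open>c\<^sup>m\<close>.
\<close>

lemma mod_ring_power_sum:
  "(\<Sum>c\<in>UNIV - {0}. c ^ m :: 'p::prime_card mod_ring) = (if (CARD('p) - 1) dvd m then - 1 else 0)"
proof (cases "(CARD('p) - 1) dvd m")
  case True
  have "c ^ m = 1" if "c \<noteq> 0" for c :: "'p mod_ring"
    using mod_ring_power_cong[OF that, of m 0] True by simp
  then have "(\<Sum>c\<in>UNIV - {0}. c ^ m :: 'p mod_ring) = of_nat (CARD('p) - 1)"
    by simp
  also have "\<dots> = - 1"
    using finite_UNIV_card_ge_0[where ?'a = 'p] by (simp add: of_nat_diff Suc_leI)
  finally show ?thesis
    using True by simp
next
  case False
  define q where "q = CARD('p) - 1"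
  have q: "q > 0"
    using prime_gt_1_nat[OF prime_card[where ?'a = 'p]] by (simp add: q_def)
  define k where "k = m mod q"
  have k: "0 < k" "k < q"
    using False q mod_greater_zero_iff_not_dvd[of m q] by (simp_all add: k_def q_def)
  define f :: "'p mod_ring poly" where "f = monom 1 k - 1"
  have "coeff f k = 1"
    using k by (simp add: f_def coeff_1)
  then have "f \<noteq> 0"
    by auto
  have "degree f \<le> k"
    unfolding f_def by (intro degree_diff_le) (auto simp: degree_monom_le)
  then have "card {c. poly f c = 0} \<le> k"
    using card_poly_roots_bound[OF \<open>f \<noteq> 0\<close>] by (meson le_trans)
  also have "\<dots> < card (UNIV - {0 :: 'p mod_ring})"
    using k by (simp add: q_def)
  finally have "\<not> UNIV - {0} \<subseteq> {c. poly f c = 0}"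
    using card_mono[of "{c. poly f c = 0}" "UNIV - {0}"] by auto
  then obtain c where "c \<noteq> 0" "poly f c \<noteq> 0"
    by auto
  then have c: "c \<noteq> 0" "c ^ m \<noteq> 1"
    using mod_ring_power_cong[OF \<open>c \<noteq> 0\<close>, of m k] by (auto simp: f_def poly_monom k_def q_def)
  have "(\<Sum>x\<in>UNIV - {0}. x ^ m) = (\<Sum>x\<in>UNIV - {0}. (c * x) ^ m)"
    by (rule sum.reindex_bij_witness[of _ "\<lambda>x. c * x" "\<lambda>x. x / c"]) (use c in auto)
  also have "\<dots> = c ^ m * (\<Sum>x\<in>UNIV - {0}. x ^ m)"
    by (simp add: power_mult_distrib sum_distrib_left)
  finally have "(c ^ m - 1) * (\<Sum>x\<in>UNIV - {0}. x ^ m) = 0"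
    unfolding left_diff_distrib by simp
  then have "(\<Sum>x\<in>UNIV - {0}. x ^ m :: 'p mod_ring) = 0"
    using c(2) by simp
  with False show ?thesis
    by simp
qed

definition weight_part :: "nat \<Rightarrow> nat \<Rightarrow> 'k::field poly \<Rightarrow> 'k poly" where
  "weight_part q s g = Abs_poly (\<lambda>n. if n mod q = s mod q then coeff g n else 0)"

lemma coeff_weight_part:
  "coeff (weight_part q s g) n = (if n mod q = s mod q then coeff g n else 0)"
proof -
  have "\<forall>\<^sub>\<infinity>n. (if n mod q = s mod q then coeff g n else 0) = 0"
    unfolding MOST_nat by (intro exI[of _ "degree g"]) (simp add: coeff_eq_0)
  then show ?thesis
    by (simp add: weight_part_def Abs_poly_inverse)
qed

text \<open>
  Orthogonality of characters: \<open>diag(1, c)\<close> multiplies \<open>X\<^bsup>r-n\<^esup> Y\<^sup>n\<close> by \<open>c\<^sup>n\<close>, so the sum over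
  \<open>c \<noteq> 0\<close> of \<open>c\<^bsup>-s\<^esup>\<close> times the translate by \<open>diag(1, c)\<close> is the negative of the part of weight \<open>s\<close>.
\<close>

lemma homogenize_weight_part_mem:
  fixes g :: "'p::prime_card mod_ring poly"
  assumes t: "gl2_submodule r t" and g: "homogenize r g \<in> t"
  shows "homogenize r (weight_part (CARD('p) - 1) s g) \<in> t"
proof -
  define q where "q = CARD('p) - 1"
  have q: "q > 0"
    using prime_gt_1_nat[OF prime_card[where ?'a = 'p]] by (simp add: q_def)
  \<comment> \<open>A natural number representing the exponent \<open>-s\<close> modulo \<open>p - 1\<close>.\<close>
  define e where "e = (q - 1) * s"
  define A :: "'p mod_ring \<Rightarrow> 'p mod_ring ^ 2 ^ 2"
    where "A c = vector [vector [1, 0], vector [0, c]]" for c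
  have inv: "invertible (A c)" if "c \<noteq> 0" for c
    using that by (simp add: invertible_det_nz det_2 A_def vector_2)
  have act: "gl2_act (A c) (homogenize r g)
      = (\<Sum>n\<le>r. bscale (coeff g n * c ^ n) (bvar_X ^ (r - n) * bvar_Y ^ n))" for c
  proof -
    have "(bscale c bvar_Y) ^ n = bscale (c ^ n) (bvar_Y ^ n)" for n
      by (induction n) (simp_all add: bscale_def bconst_def one_pCons mult_ac)
    then have "gl2_act (A c) (bvar_X ^ m * bvar_Y ^ n) = bscale (c ^ n) (bvar_X ^ m * bvar_Y ^ n)" for m n
      unfolding gl2_act_monomial by (simp add: A_def vector_2) (simp add: bscale_def mult_ac)
    then show ?thesis
      by (simp add: homogenize_def gl2_act.hom_sum gl2_act_bscale)
  qed
  have sub: "bivar.subspace t"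
    using t by (simp add: gl2_submodule_def)
  have weight: "q dvd n + e \<longleftrightarrow> n mod q = s mod q" for n
  proof -
    have "q dvd n + e \<longleftrightarrow> int q dvd int (n + e)"
      by (simp only: int_dvd_int_iff)
    also have "int (n + e) = (int n - int s) + int q * int s"
      using q by (cases q) (simp_all add: e_def algebra_simps)
    also have "int q dvd \<dots> \<longleftrightarrow> int n mod int q = int s mod int q"
      by (subst dvd_add_left_iff) (simp_all add: mod_eq_dvd_iff)
    finally show ?thesis
      by (simp add: zmod_int[symmetric])
  qed
  have "(\<Sum>c\<in>UNIV - {0}. bscale (c ^ e) (gl2_act (A c) (homogenize r g)))
      = (\<Sum>n\<le>r. bscale (coeff g n * (\<Sum>c\<in>UNIV - {0}. c ^ (n + e))) (bvar_X ^ (r - n) * bvar_Y ^ n))"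
    unfolding act bivar.scale_sum_right
    by (subst sum.swap) (simp add: sum_distrib_left bivar.scale_sum_left power_add mult_ac)
  also have "\<dots> = bscale (- 1) (homogenize r (weight_part q s g))"
    unfolding homogenize_def bivar.scale_sum_right mod_ring_power_sum weight[unfolded q_def]
    by (intro sum.cong) (auto simp: coeff_weight_part q_def)
  finally have "bscale (- 1) (homogenize r (weight_part q s g))
      = (\<Sum>c\<in>UNIV - {0}. bscale (c ^ e) (gl2_act (A c) (homogenize r g)))" ..
  also have "\<dots> \<in> t"
    using t g inv by (intro bivar.subspace_sum[OF sub] bivar.subspace_scale[OF sub])
      (auto simp: gl2_submodule_def)
  finally have "bscale (- 1) (homogenize r (weight_part q s g)) \<in> t" .
  then have "bscale (- 1) (bscale (- 1) (homogenize r (weight_part q s g))) \<in> t"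
    by (rule bivar.subspace_scale[OF sub])
  then show ?thesis
    by (simp add: q_def)
qed

section \<open>Monomials in submodules\<close>

lemma gl2_submodule_subspace: "gl2_submodule r t \<Longrightarrow> bivar.subspace t"
  by (simp add: gl2_submodule_def)

lemma monomial_submodule_subset_iff:
  assumes "i \<le> r" and "j \<le> r"
  shows "monomial_submodule (r - i) r \<subseteq> (monomial_submodule (r - j) r :: 'k::field poly poly set)
    \<longleftrightarrow> (\<forall>t :: 'k poly poly set. gl2_submodule r t \<longrightarrow> bvar_X ^ (r - j) * bvar_Y ^ j \<in> t
          \<longrightarrow> bvar_X ^ (r - i) * bvar_Y ^ i \<in> t)"
  using assms unfolding monomial_submodule_def hull_def by auto

text \<open>
  Among the exponents \<open>0, \<dots>, i\<close> the only ones that can agree modulo \<open>p - 1\<close> are \<open>0\<close> and \<open>p - 1 = i\<close>. So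
  each weight part of \<open>X\<^bsup>r-i\<^esup> (X + Y)\<^sup>i\<close> is a single monomial, up to a multiple of the given one.
\<close>

lemma lower_monomial_mem:
  fixes t :: "'p::prime_card mod_ring poly poly set"
  assumes t: "gl2_submodule r t" and i: "bvar_X ^ (r - i) * bvar_Y ^ i \<in> t"
    and "k \<le> i" and "i \<le> r" and "i \<le> CARD('p) - 1"
  shows "bvar_X ^ (r - k) * bvar_Y ^ k \<in> t"
proof (cases "k = i")
  case False
  define q where "q = CARD('p) - 1"
  note sub = gl2_submodule_subspace[OF t]
  define U :: "'p mod_ring ^ 2 ^ 2" where "U = vector [vector [1, 1], vector [0, 1]]"
  have "invertible U"
    by (simp add: invertible_det_nz det_2 U_def vector_2)
  then have "gl2_act U (bvar_X ^ (r - i) * bvar_Y ^ i) \<in> t"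
    using t i by (simp add: gl2_submodule_def)
  also have "gl2_act U (bvar_X ^ (r - i) * bvar_Y ^ i) = homogenize r ([:1, 1:] ^ i)"
    using homogenize_linear_power[of i 0 r, where ?'k = "'p mod_ring"] assms(4)
    unfolding gl2_act_monomial by (simp add: U_def vector_2 monom_0 flip: one_pCons)
  finally have mem: "homogenize r (weight_part q k ([:1, 1:] ^ i)) \<in> t"
    unfolding q_def by (rule homogenize_weight_part_mem[OF t])
  have eq: "(weight_part q k ([:1, 1:] ^ i) :: 'p mod_ring poly)
      = monom (of_nat (i choose k)) k + monom (coeff (weight_part q k ([:1, 1:] ^ i)) i) i"
  proof (rule poly_eqI)
    fix n
    have "n = k" if "n mod q = k mod q" "n < i"
      using that assms(3,5) False by (simp add: q_def)
    then show "coeff (weight_part q k ([:1, 1:] ^ i)) n = coeff (monom (of_nat (i choose k)) k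
        + monom (coeff (weight_part q k ([:1, 1:] ^ i)) i) i :: 'p mod_ring poly) n"
      using False by (cases n i rule: linorder_cases)
        (auto simp: coeff_weight_part coeff_one_plus_Y_power binomial_eq_0)
  qed
  define c where "c = coeff (weight_part q k ([:1, 1:] ^ i) :: 'p mod_ring poly) i"
  have "homogenize r (weight_part q k ([:1, 1:] ^ i))
      = bscale (of_nat (i choose k)) (bvar_X ^ (r - k) * bvar_Y ^ k)
        + bscale c (bvar_X ^ (r - i) * bvar_Y ^ i)"
    using assms(3,4) by (subst eq) (simp add: homogenize_add homogenize_monom c_def)
  then have "bscale (of_nat (i choose k)) (bvar_X ^ (r - k) * bvar_Y ^ k) \<in> t"
    using bivar.subspace_diff[OF sub mem bivar.subspace_scale[OF sub i, of c]] by simp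
  then have "bscale (inverse (of_nat (i choose k)))
      (bscale (of_nat (i choose k)) (bvar_X ^ (r - k) * bvar_Y ^ k)) \<in> t"
    by (rule bivar.subspace_scale[OF sub])
  moreover have "i < CARD('p)"
    using assms(5) prime_gt_1_nat[OF prime_card[where ?'a = 'p]] by linarith
  then have "(of_nat (i choose k) :: 'p mod_ring) \<noteq> 0"
    using assms(3) by (intro of_nat_binomial_small_neq_0) simp_all
  ultimately show ?thesis
    by simp
qed (use i in simp)

text \<open>
  In homogeneous terms: \<open>(X + Y)\<^sup>N G \<in> t\<close> for all forms \<open>G\<close> of degree \<open>j\<close>.
\<close>

lemma homogenize_linear_power_mult_mem:
  fixes t :: "'p::prime_card mod_ring poly poly set"
  assumes t: "gl2_submodule (N + j) t"
    and mono: "\<And>k. k \<le> j \<Longrightarrow> bvar_X ^ (N + j - k) * bvar_Y ^ k \<in> t"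
    and A: "degree A \<le> j"
  shows "homogenize (N + j) ([:1, 1:] ^ N * A) \<in> t"
proof -
  define r where "r = N + j"
  note sub = gl2_submodule_subspace[OF t]
  define U :: "'p mod_ring ^ 2 ^ 2" where "U = vector [vector [1, 0], vector [1, 1]]"
  have inv: "invertible U"
    by (simp add: invertible_det_nz det_2 U_def vector_2)
  have *: "homogenize r ([:1, 1:] ^ a * monom 1 b) \<in> t" if "N \<le> a" "a + b \<le> r" for a b
    using that
  proof (induction "r - (a + b)" arbitrary: a b)
    case 0
    then have a: "a + b = r" "b \<le> j"
      by (simp_all add: r_def)
    have "gl2_act U (bvar_X ^ (r - b) * bvar_Y ^ b) \<in> t"
      using t inv mono[OF a(2)] by (simp add: gl2_submodule_def r_def)
    also have "gl2_act U (bvar_X ^ (r - b) * bvar_Y ^ b) = homogenize r ([:1, 1:] ^ a * monom 1 b)"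
      using homogenize_linear_power[of a b r, where ?'k = "'p mod_ring"] a(1)
      unfolding gl2_act_monomial by (auto simp: U_def vector_2)
    finally show ?case .
  next
    case (Suc d)
    \<comment> \<open>From \<open>1 = (1 + Y) - Y\<close>: both terms on the right have total degree one higher.\<close>
    have "[:1, 1:] ^ a * monom 1 b = [:1, 1:] ^ Suc a * monom 1 b
        + smult (- 1) ([:1, 1:] ^ a * monom (1 :: 'p mod_ring) (Suc b))"
      by (simp add: monom_Suc algebra_simps)
    moreover have "homogenize r ([:1, 1:] ^ Suc a * monom 1 b) \<in> t"
      "homogenize r ([:1, 1:] ^ a * monom 1 (Suc b)) \<in> t"
      using Suc.hyps(2) Suc.prems by (intro Suc.hyps(1); simp)+
    ultimately show ?case
      by (metis homogenize_add homogenize_smult bivar.subspace_add[OF sub] bivar.subspace_scale[OF sub])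
  qed
  have "[:1, 1:] ^ N * A = (\<Sum>k\<le>j. smult (coeff A k) ([:1, 1:] ^ N * monom 1 k))"
    by (subst poly_as_sum_of_monoms'[OF A, symmetric])
      (simp add: sum_distrib_left smult_monom flip: mult_smult_right)
  then have "homogenize r ([:1, 1:] ^ N * A)
      = (\<Sum>k\<le>j. bscale (coeff A k) (homogenize r ([:1, 1:] ^ N * monom 1 k)))"
    by (simp add: homogenize_sum homogenize_smult)
  also have "\<dots> \<in> t"
    by (intro bivar.subspace_sum[OF sub] bivar.subspace_scale[OF sub] *) (simp_all add: r_def)
  finally show ?thesis
    by (simp add: r_def)
qed

lemma monomial_mem_of_isolated_coeff:
  fixes t :: "'p::prime_card mod_ring poly poly set" and A :: "'p mod_ring poly"
  assumes t: "gl2_submodule r t" and j: "bvar_X ^ (r - j) * bvar_Y ^ j \<in> t"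
    and "j < i" and "i \<le> CARD('p) - 1" and "i \<le> r"
    and A: "degree A \<le> j" "coeff ([:1, 1:] ^ (r - j) * A) i \<noteq> 0"
      "\<And>n. n mod (CARD('p) - 1) = i mod (CARD('p) - 1) \<Longrightarrow> j < n \<Longrightarrow> n \<noteq> i
        \<Longrightarrow> coeff ([:1, 1:] ^ (r - j) * A) n = 0"
  shows "bvar_X ^ (r - i) * bvar_Y ^ i \<in> t"
proof -
  note sub = gl2_submodule_subspace[OF t]
  define g where "g = weight_part (CARD('p) - 1) i ([:1, 1:] ^ (r - j) * A)"
  have r: "r - j + j = r"
    using assms(3,5) by simp
  have low: "bvar_X ^ (r - k) * bvar_Y ^ k \<in> t" if "k \<le> j" for k
    using lower_monomial_mem[OF t j that] assms(3-5) by simp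
  have "homogenize r ([:1, 1:] ^ (r - j) * A) \<in> t"
    using homogenize_linear_power_mult_mem[of "r - j" j t A] t low A(1) unfolding r by blast
  then have "homogenize r g \<in> t"
    unfolding g_def by (rule homogenize_weight_part_mem[OF t])
  also have "homogenize r g = (\<Sum>n\<in>insert i {..j}. bscale (coeff g n) (bvar_X ^ (r - n) * bvar_Y ^ n))"
    unfolding homogenize_def
    by (rule sum.mono_neutral_right) (use assms(3,5) A(3) in \<open>auto simp: g_def coeff_weight_part\<close>)
  also have "\<dots> = bscale (coeff g i) (bvar_X ^ (r - i) * bvar_Y ^ i)
      + (\<Sum>n\<le>j. bscale (coeff g n) (bvar_X ^ (r - n) * bvar_Y ^ n))"
    using assms(3) by simp
  finally have sum: "bscale (coeff g i) (bvar_X ^ (r - i) * bvar_Y ^ i)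
      + (\<Sum>n\<le>j. bscale (coeff g n) (bvar_X ^ (r - n) * bvar_Y ^ n)) \<in> t" .
  have "(\<Sum>n\<le>j. bscale (coeff g n) (bvar_X ^ (r - n) * bvar_Y ^ n)) \<in> t"
    using low by (intro bivar.subspace_sum[OF sub] bivar.subspace_scale[OF sub]) simp
  from bivar.subspace_diff[OF sub sum this]
  have "bscale (coeff g i) (bvar_X ^ (r - i) * bvar_Y ^ i) \<in> t"
    by simp
  then have "bscale (inverse (coeff g i)) (bscale (coeff g i) (bvar_X ^ (r - i) * bvar_Y ^ i)) \<in> t"
    by (rule bivar.subspace_scale[OF sub])
  moreover have "coeff g i \<noteq> 0"
    using A(2) by (simp add: g_def coeff_weight_part)
  ultimately show ?thesis
    by simp
qed

section \<open>Coefficients of the elements of the span of an orbit\<close>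

text \<open>
  The span is a concrete submodule, and testing on it bounds the generated submodule from above.
\<close>

lemma gl2_submodule_span_orbit:
  fixes a b :: nat
  defines "G \<equiv> {gl2_act A (bvar_X ^ a * bvar_Y ^ b) | A :: 'k::field ^ 2 ^ 2. invertible A}"
  shows "gl2_submodule (a + b) (bivar.span G)"
proof -
  have "bvar_X ^ a * bvar_Y ^ b \<in> homogeneous_polys (a + b)"
    unfolding bvar_monomial by (auto simp: homogeneous_polys_def split: if_splits)
  then have "G \<subseteq> homogeneous_polys (a + b)"
    using gl2_submodule_homogeneous[of "a + b", where ?'a = 'k] by (auto simp: G_def gl2_submodule_def)
  then have "bivar.span G \<subseteq> homogeneous_polys (a + b)"
    by (rule bivar.span_minimal) (rule subspace_homogeneous)
  moreover have "gl2_act B F \<in> bivar.span G" if B: "invertible B" and F: "F \<in> bivar.span G" for B F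
    using F
  proof (induction rule: bivar.span_induct_alt)
    case base
    show ?case
      by (simp add: bivar.span_zero)
  next
    case (step c x y)
    then obtain A where "invertible A" "x = gl2_act A (bvar_X ^ a * bvar_Y ^ b)"
      by (auto simp: G_def)
    then have "gl2_act B x \<in> G"
      using B unfolding G_def by (auto simp: gl2_act_comp_monomial intro!: invertible_mult)
    with step show ?case
      by (simp add: gl2_act.hom_add gl2_act_bscale bivar.span_add bivar.span_scale bivar.span_base)
  qed
  ultimately show ?thesis
    by (simp add: gl2_submodule_def bivar.subspace_span)
qed

text \<open>
  Consider \<open>(a X + c Y)\<^sup>N (b X + d Y)\<^sup>j\<close>. For \<open>a = 0\<close> or \<open>c = 0\<close> no exponent of \<open>Y\<close> strictly between
  \<open>j\<close> and \<open>N\<close> occurs. Otherwise let \<open>e = c / a\<close>; as \<open>e\<^bsup>n-k\<^esup>\<close> depends only on \<open>n\<close> modulo \<open>p - 1\<close>, within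
  one weight the powers of \<open>e\<close> can be moved from the factor \<open>(X + e Y)\<^sup>N\<close> into the second factor.
\<close>

lemma weight_coeffs_of_orbit:
  fixes B :: "'p::prime_card mod_ring ^ 2 ^ 2"
  assumes "j < i"
  shows "\<exists>A. degree A \<le> j \<and> (\<forall>n. n mod (CARD('p) - 1) = i mod (CARD('p) - 1) \<longrightarrow> j < n \<longrightarrow> n < N \<longrightarrow>
    coeff (dehomogenize (gl2_act B (bvar_X ^ N * bvar_Y ^ j))) n = coeff ([:1, 1:] ^ N * A) n)"
proof -
  define a b c d where "a = B $ 1 $ 1" and "b = B $ 1 $ 2" and "c = B $ 2 $ 1" and "d = B $ 2 $ 2"
  define H where "H = [:b, d:] ^ j"
  have D: "dehomogenize (gl2_act B (bvar_X ^ N * bvar_Y ^ j)) = [:a, c:] ^ N * H"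
    unfolding gl2_act_monomial a_def b_def c_def d_def H_def
    by (simp add: dehomogenize.hom_mult dehomogenize.hom_power dehomogenize_linear)
  have "degree H \<le> degree [:b, d:] * j"
    unfolding H_def by (rule degree_power_le)
  also have "\<dots> \<le> 1 * j"
    by (intro mult_le_mono1) simp
  finally have degH: "degree H \<le> j"
    by simp
  consider "a = 0" | "c = 0" | "a \<noteq> 0" "c \<noteq> 0"
    by blast
  then show ?thesis
  proof cases
    case 1
    have "[:0, c:] ^ N = monom (c ^ N) N"
      by (metis monom_0 monom_Suc monom_power mult_1 One_nat_def)
    then have "coeff ([:a, c:] ^ N * H) n = 0" if "n < N" for n
      using that 1 by (simp add: coeff_monom_mult)
    then show ?thesis
      unfolding D by (intro exI[of _ 0]) simp
  next
    case 2
    have "[:a:] ^ N = [:a ^ N:]"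
      by (induction N) (simp_all add: one_pCons)
    then have "coeff ([:a, c:] ^ N * H) n = 0" if "j < n" for n
      using that 2 degH by (simp add: coeff_eq_0)
    then show ?thesis
      unfolding D by (intro exI[of _ 0]) simp
  next
    case 3
    define e where "e = c / a"
    have e: "e \<noteq> 0"
      using 3 by (simp add: e_def)
    have "[:a, c:] = smult a [:1, e:]"
      using 3 by (simp add: e_def)
    then have ac: "[:a, c:] ^ N = smult (a ^ N) ([:1, e:] ^ N)"
      by (simp only: smult_power)
    define A where "A = (\<Sum>k\<le>j. monom (a ^ N * coeff H k * e ^ (i - k)) k)"
    have A: "coeff A k = (if k \<le> j then a ^ N * coeff H k * e ^ (i - k) else 0)" for k
      by (simp add: A_def coeff_sum)
    have "degree A \<le> j"
      by (rule degree_le) (simp add: A)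
    moreover have "coeff ([:a, c:] ^ N * H) n = coeff ([:1, 1:] ^ N * A) n"
      if n: "n mod (CARD('p) - 1) = i mod (CARD('p) - 1)" "j < n" for n
    proof -
      have "coeff ([:a, c:] ^ N * H) n = (\<Sum>k\<le>n. a ^ N * coeff H k * (of_nat (N choose (n - k)) * e ^ (n - k)))"
        unfolding ac mult_smult_left mult.commute[of "[:1, e:] ^ N"]
        by (simp add: coeff_mult coeff_one_plus_Y_power sum_distrib_left mult_ac)
      also have "\<dots> = (\<Sum>k\<le>n. coeff A k * of_nat (N choose (n - k)))"
      proof (intro sum.cong refl)
        fix k
        show "a ^ N * coeff H k * (of_nat (N choose (n - k)) * e ^ (n - k))
            = coeff A k * of_nat (N choose (n - k))"
        proof (cases "k \<le> j")
          case True
          then have "[n - k + k = i - k + k] (mod (CARD('p) - 1))"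
            using n assms by (simp add: cong_def)
          then have "e ^ (n - k) = e ^ (i - k)"
            unfolding cong_add_rcancel_nat by (intro mod_ring_power_cong[OF e]) (simp only: cong_def)
          with True show ?thesis
            by (simp add: A)
        next
          case False
          then show ?thesis
            using degH by (simp add: A coeff_eq_0)
        qed
      qed
      also have "\<dots> = coeff ([:1, 1:] ^ N * A) n"
        unfolding mult.commute[of "[:1, 1:] ^ N"] by (simp add: coeff_mult coeff_one_plus_Y_power)
      finally show ?thesis .
    qed
    ultimately show ?thesis
      unfolding D by blast
  qed
qed

lemma weight_coeffs_of_span_orbit:
  fixes F :: "'p::prime_card mod_ring poly poly"
  assumes "j < i"
    and "F \<in> bivar.span {gl2_act A (bvar_X ^ N * bvar_Y ^ j) | A. invertible A}"
  shows "\<exists>A. degree A \<le> j \<and> (\<forall>n. n mod (CARD('p) - 1) = i mod (CARD('p) - 1) \<longrightarrow> j < n \<longrightarrow> n < N \<longrightarrow>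
    coeff (dehomogenize F) n = coeff ([:1, 1:] ^ N * A) n)"
  using assms(2)
proof (induction rule: bivar.span_induct_alt)
  case base
  show ?case
    by (intro exI[of _ 0]) simp
next
  case (step c x y)
  then obtain A where A: "degree A \<le> j" "\<And>n. n mod (CARD('p) - 1) = i mod (CARD('p) - 1) \<Longrightarrow> j < n
      \<Longrightarrow> n < N \<Longrightarrow> coeff (dehomogenize x) n = coeff ([:1, 1:] ^ N * A) n"
    using weight_coeffs_of_orbit[OF assms(1), of N] by blast
  from step obtain A' where A': "degree A' \<le> j" "\<And>n. n mod (CARD('p) - 1) = i mod (CARD('p) - 1) \<Longrightarrow> j < n
      \<Longrightarrow> n < N \<Longrightarrow> coeff (dehomogenize y) n = coeff ([:1, 1:] ^ N * A') n"
    by blast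
  have "degree (smult c A + A') \<le> j"
    using A(1) A'(1) by (intro degree_add_le) (auto intro: le_trans[OF degree_smult_le])
  moreover have "coeff (dehomogenize (bscale c x + y)) n = coeff ([:1, 1:] ^ N * (smult c A + A')) n"
    if "n mod (CARD('p) - 1) = i mod (CARD('p) - 1)" "j < n" "n < N" for n
    using A(2)[OF that] A'(2)[OF that]
    by (simp add: dehomogenize.hom_add dehomogenize_bscale algebra_simps)
  ultimately show ?case
    by blast
qed

section \<open>Equality in terms of digits\<close>

text \<open>
  The inclusion of the submodule of \<open>j\<close> in that of \<open>i\<close> always holds, so only the monomial of \<open>i\<close> has
  to be located: the span of the orbit of the monomial of \<open>j\<close> settles one direction, an arbitrary
  submodule containing the monomial of \<open>j\<close> the other.
\<close>

lemma monomial_submodules_eq_iff_digits: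
  fixes i j r :: nat
  defines "p \<equiv> CARD('p::prime_card)"
  assumes "j < i" and "i \<le> p - 1" and "p \<le> r"
  shows "(monomial_submodule (r - j) r :: 'p mod_ring poly poly set) = monomial_submodule (r - i) r
    \<longleftrightarrow> i \<le> (r - j) mod p + j \<and> digit_sum p (r - j) \<le> min (p - 1) ((r - j) mod p + j)"
    (is "?L = ?R \<longleftrightarrow> ?C")
proof -
  have char: "CHAR('p mod_ring) = p"
    by (simp add: p_def)
  have p: "p \<ge> 2"
    unfolding p_def using prime_card prime_ge_2_nat by blast
  have ir: "i \<le> r" "j \<le> r"
    using assms by simp_all
  have "?L \<subseteq> ?R"
    unfolding monomial_submodule_subset_iff[OF ir(2,1)]
    using lower_monomial_mem[where ?'p = 'p, of r _ i j] ir assms(2,3) p_def by simp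
  moreover have "?R \<subseteq> ?L" if c: ?C
  proof -
    obtain A :: "'p mod_ring poly" where A: "degree A \<le> j" "coeff ([:1, 1:] ^ (r - j) * A) i \<noteq> 0"
        "\<And>n. n mod (p - 1) = i mod (p - 1) \<Longrightarrow> j < n \<Longrightarrow> n \<noteq> i \<Longrightarrow> coeff ([:1, 1:] ^ (r - j) * A) n = 0"
      using ex_multiple_with_isolated_coeff[where ?'k = "'p mod_ring", unfolded char, of j i "r - j"]
        c assms(2,3) by blast
    show ?thesis
      unfolding monomial_submodule_subset_iff[OF ir]
      using monomial_mem_of_isolated_coeff[OF _ _ assms(2) assms(3)[unfolded p_def] ir(1) A[unfolded p_def]]
      by blast
  qed
  moreover have ?C if sub: "?R \<subseteq> ?L"
  proof (cases "i < r - j")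
    case True
    let ?G = "{gl2_act A (bvar_X ^ (r - j) * bvar_Y ^ j) | A :: 'p mod_ring ^ 2 ^ 2. invertible A}"
    have "gl2_submodule r (bivar.span ?G)"
      using gl2_submodule_span_orbit[of "r - j" j, where ?'k = "'p mod_ring"] ir by simp
    moreover have "bvar_X ^ (r - j) * bvar_Y ^ j \<in> bivar.span ?G"
    proof (rule bivar.span_base)
      have "gl2_act (mat 1) (bvar_X ^ (r - j) * bvar_Y ^ j :: 'p mod_ring poly poly)
          = bvar_X ^ (r - j) * bvar_Y ^ j"
        unfolding gl2_act_monomial by (simp add: mat_def)
      moreover have "invertible (mat 1 :: 'p mod_ring ^ 2 ^ 2)"
        by (simp add: invertible_det_nz)
      ultimately show "bvar_X ^ (r - j) * bvar_Y ^ j \<in> ?G"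
        by (metis (mono_tags, lifting) mem_Collect_eq)
    qed
    ultimately have "bvar_X ^ (r - i) * bvar_Y ^ i \<in> bivar.span ?G"
      using sub unfolding monomial_submodule_subset_iff[OF ir] by blast
    from weight_coeffs_of_span_orbit[OF assms(2) this] obtain A :: "'p mod_ring poly"
      where A: "degree A \<le> j" "\<And>n. n mod (p - 1) = i mod (p - 1) \<Longrightarrow> j < n \<Longrightarrow> n < r - j
        \<Longrightarrow> coeff (monom 1 i) n = coeff ([:1, 1:] ^ (r - j) * A) n"
      unfolding dehomogenize_monomial p_def by blast
    show ?thesis
      by (rule degree_bound_of_isolated_coeff[where ?'k = "'p mod_ring", unfolded char, of A])
        (use A assms(2,3) True in \<open>auto simp flip: A(2)\<close>)
  next
    case False
    \<comment> \<open>For \<open>i \<ge> r - j\<close> the criterion holds because \<open>r - j\<close> is a single digit and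
       \<open>(r - j) + j = r \<ge> p\<close>.\<close>
    then have "r - j < p"
      using assms(3) p by linarith
    then show ?thesis
      using assms(3,4) ir by simp
  qed
  ultimately show ?thesis
    by blast
qed

section \<open>Carry patterns\<close>

text \<open>
  For \<open>l < p\<close> a carry out of the last digit occurs precisely when the last digit of \<open>r\<close> is less
  than \<open>l\<close>. The second equation is the last digit of the addition.
\<close>

lemma first_carry:
  assumes "p \<ge> 2" and "l < p" and "l \<le> r"
  shows "add_carry p l (r - l) (Suc 0) = (if l \<le> r mod p then 0 else 1)"
    and "(r - l) mod p + l = r mod p + p * (if l \<le> r mod p then 0 else 1)"
proof -
  have eq: "(r - l) mod p + l = r mod p + p * add_carry p l (r - l) (Suc 0)"
    using add_carry_eq[OF assms(1), of l 0 "r - l"] assms(2,3)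
    by (simp add: base_digit_def del: add_carry.simps(2))
  have "(r - l) mod p < p"
    using assms(1) by simp
  moreover have "add_carry p l (r - l) (Suc 0) = 0 \<or> add_carry p l (r - l) (Suc 0) = 1"
    using add_carry_le_1[OF assms(1), of l "r - l" "Suc 0"] by linarith
  ultimately show c: "add_carry p l (r - l) (Suc 0) = (if l \<le> r mod p then 0 else 1)"
    using eq by (auto simp del: add_carry.simps)
  show "(r - l) mod p + l = r mod p + p * (if l \<le> r mod p then 0 else 1)"
    using eq unfolding c .
qed

text \<open>
  From the second digit on \<open>l\<close> has only zeros, so a carry propagates exactly through the zero digits
  of \<open>r\<close>, and this no longer depends on \<open>l\<close>.
\<close>

lemma next_carry:
  assumes "p \<ge> 2" and "l < p" and "l \<le> r"
  shows "add_carry p l (r - l) (Suc (Suc n))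
    = (if add_carry p l (r - l) (Suc n) = 1 \<and> base_digit p r (Suc n) = 0 then 1 else 0)"
proof -
  have "p ^ 1 \<le> p ^ Suc n"
    by (rule power_increasing) (use assms(1) in auto)
  then have "l < p ^ Suc n"
    using assms(2) by (metis less_le_trans power_one_right)
  then have "base_digit p l (Suc n) = 0"
    unfolding base_digit_def by (simp only: div_less mod_0)
  then have eq: "base_digit p (r - l) (Suc n) + add_carry p l (r - l) (Suc n)
      = base_digit p r (Suc n) + p * add_carry p l (r - l) (Suc (Suc n))"
    using add_carry_eq[OF assms(1), of l "Suc n" "r - l"] assms(3) by simp
  have "base_digit p (r - l) (Suc n) < p"
    using assms(1) by (simp add: base_digit_def)
  moreover have "add_carry p l (r - l) m = 0 \<or> add_carry p l (r - l) m = 1" for m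
    using add_carry_le_1[OF assms(1), of l "r - l" m] by linarith
  from this[of "Suc n"] this[of "Suc (Suc n)"]
  have "add_carry p l (r - l) (Suc n) = 0 \<or> add_carry p l (r - l) (Suc n) = 1"
    "add_carry p l (r - l) (Suc (Suc n)) = 0 \<or> add_carry p l (r - l) (Suc (Suc n)) = 1" .
  ultimately show ?thesis
    using eq assms(1) by (auto simp del: add_carry.simps)
qed

lemma carry_pattern_eq_iff:
  assumes "p \<ge> 2" and "i < p" and "j < p" and "p \<le> r"
  shows "carry_pattern p r i = carry_pattern p r j \<longleftrightarrow> (i \<le> r mod p \<longleftrightarrow> j \<le> r mod p)"
proof
  have "i \<le> r" "j \<le> r"
    using assms by simp_all
  note first = first_carry(1)[OF assms(1,2) this(1)] first_carry(1)[OF assms(1,3) this(2)]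
    and later = next_carry[OF assms(1,2) this(1)] next_carry[OF assms(1,3) this(2)]
  {
    assume "carry_pattern p r i = carry_pattern p r j"
    then have "carry_pattern p r i 0 = carry_pattern p r j 0"
      by simp
    then show "i \<le> r mod p \<longleftrightarrow> j \<le> r mod p"
      unfolding carry_pattern_def first by (auto split: if_splits)
  next
    assume *: "i \<le> r mod p \<longleftrightarrow> j \<le> r mod p"
    have "add_carry p i (r - i) (Suc n) = add_carry p j (r - j) (Suc n)" for n
    proof (induction n)
      case 0
      show ?case
        unfolding first using * by simp
    next
      case (Suc n)
      show ?case
        unfolding later Suc ..
    qed
    then show "carry_pattern p r i = carry_pattern p r j"
      by (simp only: carry_pattern_def)
  }
qed

text \<open>
  If \<open>j \<le> r\<^sub>0\<close>, then \<open>r - j\<close> differs from \<open>r\<close> only in the last digit, and \<open>\<Sigma>(r - j) \<le> r\<^sub>0\<close> says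
  \<open>\<Sigma>(r - r\<^sub>0) \<le> j\<close>. If \<open>j > r\<^sub>0\<close>, the subtraction borrows from \<open>q = r div p\<close>; then
  \<open>\<Sigma>(r - j) \<le> p - 1\<close> already implies the last condition, because \<open>\<Sigma>(q) \<le> \<Sigma>(q - 1) + 1\<close>.
\<close>

lemma digit_condition_iff:
  assumes "p \<ge> 2" and "j < i" and "i \<le> p - 1" and "p \<le> r"
  shows "i \<le> (r - j) mod p + j \<and> digit_sum p (r - j) \<le> min (p - 1) ((r - j) mod p + j)
    \<longleftrightarrow> (i \<le> r mod p \<longleftrightarrow> j \<le> r mod p) \<and> digit_sum p (r - j) \<le> p - 1
      \<and> digit_sum p (r - r mod p) \<le> j"
proof -
  define r0 q where "r0 = r mod p" and "q = r div p"
  have r: "r = r0 + p * q" "r0 < p"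
    using assms(1) by (simp_all add: r0_def q_def)
  have "q > 0"
    using assms(1,4) by (simp add: q_def div_greater_zero_iff)
  have "digit_sum p (r - r0) = digit_sum p q"
    using digit_sum_rec[OF assms(1), of "p * q"] assms(1) by (simp add: r(1))
  have ds: "digit_sum p (x + p * y) = x + digit_sum p y" if "x < p" for x y
    using digit_sum_rec[OF assms(1), of "x + p * y"] that by simp
  show ?thesis
  proof (cases "j \<le> r0")
    case True
    have N: "r - j = (r0 - j) + p * q"
      using True r by simp
    moreover have "(r - j) mod p + j = r0"
      unfolding N mod_mult_self2 using True r(2) by simp
    ultimately show ?thesis
      using True r(2) \<open>digit_sum p (r - r0) = _\<close> ds[of "r0 - j" q] assms(2,3)
      unfolding r0_def[symmetric] by auto
  next
    case False
    have "p * q = p * (q - 1) + p"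
      using \<open>q > 0\<close> by (cases q) auto
    then have "r - j = (p + r0 - j) + p * (q - 1)"
      using False r assms(2,3) by simp
    moreover have "p + r0 - j < p"
      using False r(2) by simp
    ultimately have "(r - j) mod p = p + r0 - j"
      "digit_sum p (r - j) = p + r0 - j + digit_sum p (q - 1)"
      using ds by simp_all
    then have N: "(r - j) mod p + j = p + r0" "digit_sum p (r - j) + j = p + r0 + digit_sum p (q - 1)"
      using assms(2,3) by linarith+
    have "digit_sum p q \<le> Suc (digit_sum p (q - 1))"
      using digit_sum_Suc_le[OF assms(1), of "q - 1"] \<open>q > 0\<close> by simp
    then have "digit_sum p (r - r0) \<le> j" if "digit_sum p (r - j) \<le> p - 1"
      using that N(2) \<open>digit_sum p (r - r0) = _\<close> assms(1) False by linarith
    moreover have "i \<le> p + r0" "min (p - 1) (p + r0) = p - 1"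
      using assms(1,3) by linarith+
    ultimately show ?thesis
      using False assms(2) unfolding r0_def[symmetric] N(1) by auto
  qed
qed

theorem theorem1p1:
  fixes p i j r :: nat
  assumes "p = CARD('p::prime_card)"
    and "j < i" and "i \<le> p - 1" and "p \<le> r"
  shows "(monomial_submodule (r - j) r :: 'p mod_ring poly poly set) = monomial_submodule (r - i) r
    \<longleftrightarrow> carry_pattern p r i = carry_pattern p r j
      \<and> digit_sum p (r - j) \<le> p - 1
      \<and> digit_sum p (r - base_digit p r 0) \<le> j"
proof -
  have p: "p \<ge> 2"
    unfolding assms(1) using prime_card prime_ge_2_nat by blast
  have "i < p" "j < p"
    using assms(2,3) p by linarith+
  have "base_digit p r 0 = r mod p"
    by (simp add: base_digit_def)
  then show ?thesis
    unfolding carry_pattern_eq_iff[OF p \<open>i < p\<close> \<open>j < p\<close> assms(4)]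
    using monomial_submodules_eq_iff_digits[where ?'p = 'p, of j i r] digit_condition_iff[OF p assms(2-4)]
      assms by simp
qed

end
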